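(* Let $\nu\ge0$, $T>0$. For a forcing term $\mathbf f:[0,T]\to L^2(\Omega)^2$, say that $(\mathbf u_h,p_h):[0,T]\to V_h^{1}\times V_h^{2}$ ($\mathbf u_h$ being $C^1$ in time) solves $(S_{\mathbf f})$ if for all $t$, $$\int_\Omega \frac{\partial \mathbf u_h}{\partial t}\cdot \mathbf v_h+\int_\Omega \mathbf u_h\cdot s_h(\mathbf u_h,\mathbf v_h)+\int_\Omega (\widetilde{\mathrm{grad}}_h\, p_h)\cdot \mathbf v_h+\nu\int_\Omega (\widetilde{\mathrm{curl}}_h\,\mathbf u_h)(\widetilde{\mathrm{curl}}_h\,\mathbf v_h)=\int_\Omega\mathbf f\cdot P_1^c\mathbf v_h\quad\forall\,\mathbf v_h\in V_h^{1},$$ $$\int_\Omega \mathbf u_h\cdot s_h(\mathbf u_h,\widetilde{\mathrm{grad}}_h\, q_h)+\int_\Omega \widetilde{\mathrm{grad}}_h\, p_h\cdot\widetilde{\mathrm{grad}}_h\, q_h=\int_\Omega\mathbf f\cdot P_1^c\,\widetilde{\mathrm{grad}}_h\,q_h\quad\forall\, q_h\in V_h^{2}.$$ Then the following velocity invariance (pressure-robustness) property holds: for every $\psi:[0,T]\to H^1(\Omega)$ (periodic in the periodic case), replacing $\mathbf f$ by $\mathbf f+\operatorname{grad}\psi$ changes the solution $(\mathbf u_h,p_h)$ into $(\mathbf u_h,p_h+\tilde P_h^0(\psi))$; that is, $(\mathbf u_h,p_h)$ solves $(S_{\mathbf f})$ if and only if $(\mathbf u_h,p_h+\tilde P_h^0(\psi))$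 solves $(S_{\mathbf f+\operatorname{grad}\psi})$, where $\tilde P_h^0$ is the $L^2$-orthogonal projection onto the broken space $V_h^{2}$.
   Context: Setting (dimension $d=2$). $\Omega$ is a two-dimensional domain with either periodic boundary conditions (a rectangle with opposite sides identified; all function spaces are spaces of periodic functions: $V^0=H^1(\Omega)$, $V^1=H(\mathrm{div};\Omega)$, $V^2=L^2(\Omega)$) or homogeneous boundary conditions on a bounded Lipschitz domain ($V^0=H^1_0(\Omega)$, $V^1=H_0(\mathrm{div};\Omega)$, $V^2=L^2(\Omega)$). For scalar $\omega$, $\operatorname{curl}\omega=(\partial_2\omega,-\partial_1\omega)$. Broken spaces: $V_h^0,V_h^2\subset L^2(\Omega)$ and $V_h^1\subset L^2(\Omega)^2$ are finite-dimensional (finite element) spaces of bounded functions, not necessarily contained in $V^0,V^2,V^1$. The conforming subspaces are $V_h^{\ell,c}:=V_h^\ell\cap V^\ell$, and they satisfy $\operatorname{curl}V_h^{0,c}\subset V_h^{1,c}$, $\operatorname{div}V_h^{1,c}\subset V_h^{2,c}$. For each $\ell$ a linear projection $P_\ell^c:V_h^\ell\to V_h^\ell$ with $(P_\ell^c)^2=P_\ell^c$ and range $V_h^{\ell,c}$ is given (not necessarily $L^2$-orthogonal). Operators: $\operatorname{div}_h:=\operatorname{div}\circ P_1^c:V_h^1\to V_h^2$, $\operatorname{curl}_h:=\operatorname{curl}\circ P_0^c:V_h^0\to V_h^1$. $\widetilde{\mathrm{grad}}_h:V_h^2\to V_h^1$ and $\widetilde{\mathrm{curl}}_h:V_h^1\to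 V_h^0$ are defined by $\int_\Omega \widetilde{\mathrm{grad}}_h q_h\cdot\mathbf v_h=-\int_\Omega q_h\operatorname{div}_h\mathbf v_h$ and $\int_\Omega(\widetilde{\mathrm{curl}}_h\mathbf v_h)\,\omega_h=\int_\Omega\mathbf v_h\cdot\operatorname{curl}_h\omega_h$ for all $q_h\in V_h^{2}$, $\mathbf v_h\in V_h^{1}$, $\omega_h\in V_h^{0}$. For $\mathbf a\in\mathbb R^2$, $\tilde\imath^{0h}_{\mathbf a}\mathbf u_h=\tilde P_h^0(\mathbf a\cdot\mathbf u_h)$. With $\mathbf e_1,\mathbf e_2$ the canonical basis and $P_h^1$ the $L^2$-orthogonal projection onto $V_h^{1}$, $$s_h(\mathbf u_h,\mathbf v_h)=\tfrac12P_h^1\Big(\sum_{k=1}^{2}(\tilde\imath^{0h}_{\mathbf e_k}\mathbf v_h)\,\widetilde{\mathrm{grad}}_h(\tilde\imath^{0h}_{\mathbf e_k}\mathbf u_h)-(\tilde\imath^{0h}_{\mathbf e_k}\mathbf u_h)\,\widetilde{\mathrm{grad}}_h(\tilde\imath^{0h}_{\mathbf e_k}\mathbf v_h)\Big).$$ *)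

theory Defs
  imports "HOL-Analysis.Analysis"
begin

section \<open>Domains and boundary conditions\<close>

text \<open>\<open>Periodic a b\<close> is the rectangle with corners \<open>a\<close>, \<open>b\<close> and opposite sides identified: its
  functions are given on the open box (a fundamental cell), and periodicity enters through the
  test functions. \<open>Homogeneous \<Omega>\<close> is a domain \<open>\<Omega>\<close> with homogeneous boundary conditions.\<close>

datatype setting = Periodic "real^2" "real^2" | Homogeneous "(real^2) set"

fun dom2 :: "setting \<Rightarrow> (real^2) set" where
  "dom2 (Periodic a b) = box a b"
| "dom2 (Homogeneous \<Omega>) = \<Omega>"

definition lipschitz_boundary :: "(real^2) set \<Rightarrow> bool" where
  "lipschitz_boundary \<Omega> \<longleftrightarrow>
     (\<forall>x\<in>frontier \<Omega>. \<exists>r>0. \<exists>(R :: real^2 \<Rightarrow> real^2) (\<gamma> :: real \<Rightarrow> real) L. orthogonal_transformation R \<and> L-lipschitz_on UNIV \<gamma> \<and>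
        \<Omega> \<inter> ball x r = {y \<in> ball x r. R (y - x) $ 2 > \<gamma> (R (y - x) $ 1)})"

fun admissible :: "setting \<Rightarrow> bool" where
  "admissible (Periodic a b) \<longleftrightarrow> (\<forall>i. a $ i < b $ i)"
| "admissible (Homogeneous \<Omega>) \<longleftrightarrow>
     open \<Omega> \<and> connected \<Omega> \<and> \<Omega> \<noteq> {} \<and> bounded \<Omega> \<and> lipschitz_boundary \<Omega>"


section \<open>Smooth test functions\<close>

definition part :: "2 \<Rightarrow> (real^2 \<Rightarrow> real) \<Rightarrow> real^2 \<Rightarrow> real" where
  "part i \<phi> x = frechet_derivative \<phi> (at x) (axis i 1)"

definition cgrad :: "(real^2 \<Rightarrow> real) \<Rightarrow> real^2 \<Rightarrow> real^2" where
  "cgrad \<phi> x = (\<chi> i. part i \<phi> x)"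

definition cdiv :: "(real^2 \<Rightarrow> real^2) \<Rightarrow> real^2 \<Rightarrow> real" where
  "cdiv w x = (\<Sum>i\<in>UNIV. part i (\<lambda>y. w y $ i) x)"

primrec Ck :: "nat \<Rightarrow> (real^2 \<Rightarrow> real) \<Rightarrow> bool" where
  "Ck 0 \<phi> \<longleftrightarrow> continuous_on UNIV \<phi>"
| "Ck (Suc k) \<phi> \<longleftrightarrow> \<phi> differentiable_on UNIV \<and> (\<forall>i. Ck k (part i \<phi>))"

definition smooth :: "(real^2 \<Rightarrow> real) \<Rightarrow> bool" where
  "smooth \<phi> \<longleftrightarrow> (\<forall>k. Ck k \<phi>)"

text \<open>Smooth functions on the torus, respectively smooth functions compactly supported in \<open>\<Omega>\<close>.\<close>

fun test :: "setting \<Rightarrow> (real^2 \<Rightarrow> real) set" where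
  "test (Periodic a b) =
     {\<phi>. smooth \<phi> \<and> (\<forall>x i. \<phi> (x + axis i (b $ i - a $ i)) = \<phi> x)}"
| "test (Homogeneous \<Omega>) =
     {\<phi>. smooth \<phi> \<and> (\<exists>K. compact K \<and> K \<subseteq> \<Omega> \<and> (\<forall>x. x \<notin> K \<longrightarrow> \<phi> x = 0))}"


section \<open>Lebesgue and Sobolev spaces\<close>

text \<open>Elements of these spaces are functions rather than classes modulo null sets; values outside
  the domain are irrelevant.\<close>

abbreviation integ :: "(real^2) set \<Rightarrow> (real^2 \<Rightarrow> real) \<Rightarrow> real" where
  "integ \<Omega> f \<equiv> integral\<^sup>L (lebesgue_on \<Omega>) f"

abbreviation ae_eq :: "(real^2) set \<Rightarrow> (real^2 \<Rightarrow> 'b) \<Rightarrow> (real^2 \<Rightarrow> 'b) \<Rightarrow> bool" where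
  "ae_eq \<Omega> f g \<equiv> (AE x in lebesgue_on \<Omega>. f x = g x)"

definition L2 :: "(real^2) set \<Rightarrow> (real^2 \<Rightarrow> 'b::euclidean_space) set" where
  "L2 \<Omega> = {f \<in> borel_measurable (lebesgue_on \<Omega>). integrable (lebesgue_on \<Omega>) (\<lambda>x. (norm (f x))\<^sup>2)}"

definition has_weak_grad :: "setting \<Rightarrow> (real^2 \<Rightarrow> real) \<Rightarrow> (real^2 \<Rightarrow> real^2) \<Rightarrow> bool" where
  "has_weak_grad S u g \<longleftrightarrow> g \<in> L2 (dom2 S) \<and>
     (\<forall>\<phi>\<in>test S. \<forall>i. integ (dom2 S) (\<lambda>x. u x * part i \<phi> x) = - integ (dom2 S) (\<lambda>x. g x $ i * \<phi> x))"

definition has_weak_div :: "setting \<Rightarrow> (real^2 \<Rightarrow> real^2) \<Rightarrow> (real^2 \<Rightarrow> real) \<Rightarrow> bool" where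
  "has_weak_div S w d \<longleftrightarrow> d \<in> L2 (dom2 S) \<and>
     (\<forall>\<phi>\<in>test S. integ (dom2 S) (\<lambda>x. w x \<bullet> cgrad \<phi> x) = - integ (dom2 S) (\<lambda>x. d x * \<phi> x))"

definition H1 :: "setting \<Rightarrow> (real^2 \<Rightarrow> real) set" where
  "H1 S = {u \<in> L2 (dom2 S). \<exists>g. has_weak_grad S u g}"

definition Hdiv :: "setting \<Rightarrow> (real^2 \<Rightarrow> real^2) set" where
  "Hdiv S = {w \<in> L2 (dom2 S). \<exists>d. has_weak_div S w d}"

text \<open>Weak derivatives are determined up to null sets; a version is chosen.\<close>

definition wgrad :: "setting \<Rightarrow> (real^2 \<Rightarrow> real) \<Rightarrow> real^2 \<Rightarrow> real^2" where
  "wgrad S u = (SOME g. has_weak_grad S u g)"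

definition wdiv :: "setting \<Rightarrow> (real^2 \<Rightarrow> real^2) \<Rightarrow> real^2 \<Rightarrow> real" where
  "wdiv S w = (SOME d. has_weak_div S w d)"

definition wcurl :: "setting \<Rightarrow> (real^2 \<Rightarrow> real) \<Rightarrow> real^2 \<Rightarrow> real^2" where
  "wcurl S \<omega> x = vector [wgrad S \<omega> x $ 2, - (wgrad S \<omega> x $ 1)]"

text \<open>The closures of the compactly supported smooth functions (fields) in \<open>H1\<close> and \<open>Hdiv\<close>.\<close>

definition H1_0 :: "setting \<Rightarrow> (real^2 \<Rightarrow> real) set" where
  "H1_0 S = {u \<in> H1 S. \<exists>\<phi>::nat \<Rightarrow> real^2 \<Rightarrow> real. (\<forall>n. \<phi> n \<in> test S) \<and>
     (\<lambda>n. integ (dom2 S) (\<lambda>x. (\<phi> n x - u x)\<^sup>2)) \<longlonglongrightarrow> 0 \<and>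
     (\<lambda>n. integ (dom2 S) (\<lambda>x. (norm (cgrad (\<phi> n) x - wgrad S u x))\<^sup>2)) \<longlonglongrightarrow> 0}"

definition Hdiv_0 :: "setting \<Rightarrow> (real^2 \<Rightarrow> real^2) set" where
  "Hdiv_0 S = {w \<in> Hdiv S. \<exists>\<phi>::nat \<Rightarrow> real^2 \<Rightarrow> real^2. (\<forall>n i. (\<lambda>x. \<phi> n x $ i) \<in> test S) \<and>
     (\<lambda>n. integ (dom2 S) (\<lambda>x. (norm (\<phi> n x - w x))\<^sup>2)) \<longlonglongrightarrow> 0 \<and>
     (\<lambda>n. integ (dom2 S) (\<lambda>x. (cdiv (\<phi> n) x - wdiv S w x)\<^sup>2)) \<longlonglongrightarrow> 0}"

fun V0 :: "setting \<Rightarrow> (real^2 \<Rightarrow> real) set" where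
  "V0 (Periodic a b) = H1 (Periodic a b)"
| "V0 (Homogeneous \<Omega>) = H1_0 (Homogeneous \<Omega>)"

fun V1 :: "setting \<Rightarrow> (real^2 \<Rightarrow> real^2) set" where
  "V1 (Periodic a b) = Hdiv (Periodic a b)"
| "V1 (Homogeneous \<Omega>) = Hdiv_0 (Homogeneous \<Omega>)"

definition V2 :: "setting \<Rightarrow> (real^2 \<Rightarrow> real) set" where
  "V2 S = L2 (dom2 S)"


section \<open>Broken spaces\<close>

definition finite_dimensional :: "(real^2 \<Rightarrow> 'b::real_vector) set \<Rightarrow> bool" where
  "finite_dimensional V \<longleftrightarrow>
     (\<exists>B. finite B \<and> V = {(\<lambda>x. \<Sum>b\<in>B. c b *\<^sub>R b x) |c. True})"

text \<open>A finite-dimensional subspace of \<open>L2 \<Omega>\<close> is given by a linear choice of one representative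
  for each class (the last conjunct: distinct elements are distinct modulo null sets). Every
  finite-dimensional space of classes of bounded functions arises in this way.\<close>

definition broken_space :: "(real^2) set \<Rightarrow> (real^2 \<Rightarrow> 'b::euclidean_space) set \<Rightarrow> bool" where
  "broken_space \<Omega> V \<longleftrightarrow> finite_dimensional V \<and> V \<subseteq> L2 \<Omega> \<and> (\<forall>f\<in>V. bounded (f ` \<Omega>)) \<and>
     (\<forall>f\<in>V. ae_eq \<Omega> f (\<lambda>x. 0) \<longrightarrow> f = (\<lambda>x. 0))"

definition linear_projection ::
  "(real^2 \<Rightarrow> 'b::real_vector) set \<Rightarrow> (real^2 \<Rightarrow> 'b) set \<Rightarrow> ((real^2 \<Rightarrow> 'b) \<Rightarrow> real^2 \<Rightarrow> 'b) \<Rightarrow> bool" where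
  "linear_projection V W P \<longleftrightarrow>
     (\<forall>f\<in>V. \<forall>g\<in>V. \<forall>a b. P (\<lambda>x. a *\<^sub>R f x + b *\<^sub>R g x) = (\<lambda>x. a *\<^sub>R P f x + b *\<^sub>R P g x)) \<and>
     (\<forall>f\<in>V. P (P f) = P f) \<and> P ` V = W"

definition L2_proj :: "(real^2) set \<Rightarrow> (real^2 \<Rightarrow> 'b::euclidean_space) set \<Rightarrow> (real^2 \<Rightarrow> 'b) \<Rightarrow> real^2 \<Rightarrow> 'b" where
  "L2_proj \<Omega> V f = (THE p. p \<in> V \<and> (\<forall>v\<in>V. integ \<Omega> (\<lambda>x. (f x - p x) \<bullet> v x) = 0))"

text \<open>The element of \<open>V\<close> in the same class as \<open>f\<close>.\<close>

definition rep :: "(real^2) set \<Rightarrow> (real^2 \<Rightarrow> 'b) set \<Rightarrow> (real^2 \<Rightarrow> 'b) \<Rightarrow> real^2 \<Rightarrow> 'b" where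
  "rep \<Omega> V f = (THE g. g \<in> V \<and> ae_eq \<Omega> g f)"

record discretization =
  setting :: setting
  Vh0 :: "(real^2 \<Rightarrow> real) set"
  Vh1 :: "(real^2 \<Rightarrow> real^2) set"
  Vh2 :: "(real^2 \<Rightarrow> real) set"
  P0c :: "(real^2 \<Rightarrow> real) \<Rightarrow> real^2 \<Rightarrow> real"
  P1c :: "(real^2 \<Rightarrow> real^2) \<Rightarrow> real^2 \<Rightarrow> real^2"
  P2c :: "(real^2 \<Rightarrow> real) \<Rightarrow> real^2 \<Rightarrow> real"

abbreviation Om :: "discretization \<Rightarrow> (real^2) set" where
  "Om D \<equiv> dom2 (setting D)"

definition Vh0c :: "discretization \<Rightarrow> (real^2 \<Rightarrow> real) set" where
  "Vh0c D = Vh0 D \<inter> V0 (setting D)"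

definition Vh1c :: "discretization \<Rightarrow> (real^2 \<Rightarrow> real^2) set" where
  "Vh1c D = Vh1 D \<inter> V1 (setting D)"

definition Vh2c :: "discretization \<Rightarrow> (real^2 \<Rightarrow> real) set" where
  "Vh2c D = Vh2 D \<inter> V2 (setting D)"

definition broken_discretization :: "discretization \<Rightarrow> bool" where
  "broken_discretization D \<longleftrightarrow>
     admissible (setting D) \<and>
     broken_space (Om D) (Vh0 D) \<and> broken_space (Om D) (Vh1 D) \<and> broken_space (Om D) (Vh2 D) \<and>
     (\<forall>\<omega>\<in>Vh0c D. \<exists>v\<in>Vh1c D. ae_eq (Om D) v (wcurl (setting D) \<omega>)) \<and>
     (\<forall>v\<in>Vh1c D. \<exists>q\<in>Vh2c D. ae_eq (Om D) q (wdiv (setting D) v)) \<and>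
     linear_projection (Vh0 D) (Vh0c D) (P0c D) \<and>
     linear_projection (Vh1 D) (Vh1c D) (P1c D) \<and>
     linear_projection (Vh2 D) (Vh2c D) (P2c D)"

definition div_h :: "discretization \<Rightarrow> (real^2 \<Rightarrow> real^2) \<Rightarrow> real^2 \<Rightarrow> real" where
  "div_h D v = rep (Om D) (Vh2 D) (wdiv (setting D) (P1c D v))"

definition curl_h :: "discretization \<Rightarrow> (real^2 \<Rightarrow> real) \<Rightarrow> real^2 \<Rightarrow> real^2" where
  "curl_h D \<omega> = rep (Om D) (Vh1 D) (wcurl (setting D) (P0c D \<omega>))"

definition tgrad_h :: "discretization \<Rightarrow> (real^2 \<Rightarrow> real) \<Rightarrow> real^2 \<Rightarrow> real^2" where
  "tgrad_h D q = (THE g. g \<in> Vh1 D \<and>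
     (\<forall>v\<in>Vh1 D. integ (Om D) (\<lambda>x. g x \<bullet> v x) = - integ (Om D) (\<lambda>x. q x * div_h D v x)))"

definition tcurl_h :: "discretization \<Rightarrow> (real^2 \<Rightarrow> real^2) \<Rightarrow> real^2 \<Rightarrow> real" where
  "tcurl_h D v = (THE w. w \<in> Vh0 D \<and>
     (\<forall>\<omega>\<in>Vh0 D. integ (Om D) (\<lambda>x. w x * \<omega> x) = integ (Om D) (\<lambda>x. v x \<bullet> curl_h D \<omega> x)))"

definition iota_h :: "discretization \<Rightarrow> real^2 \<Rightarrow> (real^2 \<Rightarrow> real^2) \<Rightarrow> real^2 \<Rightarrow> real" where
  "iota_h D a u = L2_proj (Om D) (Vh2 D) (\<lambda>x. a \<bullet> u x)"

definition s_h :: "discretization \<Rightarrow> (real^2 \<Rightarrow> real^2) \<Rightarrow> (real^2 \<Rightarrow> real^2) \<Rightarrow> real^2 \<Rightarrow> real^2" where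
  "s_h D u v = (\<lambda>x. (1/2) *\<^sub>R L2_proj (Om D) (Vh1 D)
     (\<lambda>y. \<Sum>k\<in>UNIV. iota_h D (axis k 1) v y *\<^sub>R tgrad_h D (iota_h D (axis k 1) u) y
                   - iota_h D (axis k 1) u y *\<^sub>R tgrad_h D (iota_h D (axis k 1) v) y) x)"


section \<open>The semi-discrete problem\<close>

definition ddt :: "real \<Rightarrow> (real \<Rightarrow> real^2 \<Rightarrow> real^2) \<Rightarrow> real \<Rightarrow> real^2 \<Rightarrow> real^2" where
  "ddt T u t x = vector_derivative (\<lambda>s. u s x) (at t within {0..T})"

text \<open>For curves in a broken space, being \<open>C\<^sup>1\<close> pointwise in \<open>x\<close> is the same as having \<open>C\<^sup>1\<close>
  coefficients, since the evaluations at points of \<open>\<Omega>\<close> separate the elements of the space.\<close>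

definition C1_in_time :: "(real^2) set \<Rightarrow> real \<Rightarrow> (real \<Rightarrow> real^2 \<Rightarrow> real^2) \<Rightarrow> bool" where
  "C1_in_time \<Omega> T u \<longleftrightarrow>
     (\<forall>x\<in>\<Omega>. (\<lambda>t. u t x) differentiable_on {0..T} \<and> continuous_on {0..T} (\<lambda>t. ddt T u t x))"

definition solves :: "discretization \<Rightarrow> real \<Rightarrow> real \<Rightarrow> (real \<Rightarrow> real^2 \<Rightarrow> real^2) \<Rightarrow>
    (real \<Rightarrow> real^2 \<Rightarrow> real^2) \<Rightarrow> (real \<Rightarrow> real^2 \<Rightarrow> real) \<Rightarrow> bool" where
  "solves D \<nu> T f u p \<longleftrightarrow>
     (\<forall>t\<in>{0..T}. u t \<in> Vh1 D \<and> p t \<in> Vh2 D) \<and> C1_in_time (Om D) T u \<and>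
     (\<forall>t\<in>{0..T}.
        (\<forall>v\<in>Vh1 D.
           integ (Om D) (\<lambda>x. ddt T u t x \<bullet> v x)
           + integ (Om D) (\<lambda>x. u t x \<bullet> s_h D (u t) v x)
           + integ (Om D) (\<lambda>x. tgrad_h D (p t) x \<bullet> v x)
           + \<nu> * integ (Om D) (\<lambda>x. tcurl_h D (u t) x * tcurl_h D v x)
           = integ (Om D) (\<lambda>x. f t x \<bullet> P1c D v x)) \<and>
        (\<forall>q\<in>Vh2 D.
           integ (Om D) (\<lambda>x. u t x \<bullet> s_h D (u t) (tgrad_h D q) x)
           + integ (Om D) (\<lambda>x. tgrad_h D (p t) x \<bullet> tgrad_h D q x)
           = integ (Om D) (\<lambda>x. f t x \<bullet> P1c D (tgrad_h D q) x)))"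

end

theory Submission
  imports Defs
begin

text \<open>
  Since \<open>s_h\<close> and the curl term involve only the velocity, everything reduces to the identity
  \<open>\<integral> tgrad_h (P \<psi>) \<bullet> v = \<integral> grad \<psi> \<bullet> P1c v\<close> for \<open>v\<close> in \<open>Vh1\<close>, \<open>P\<close> being the projection onto \<open>Vh2\<close>.
  As \<open>div_h v\<close> lies in \<open>Vh2\<close>, the left-hand side is \<open>- \<integral> \<psi> div (P1c v)\<close>, and Green's formula for \<open>\<psi>\<close> in
  \<open>H1\<close> and \<open>P1c v\<close> in \<open>V1\<close> gives the right-hand side. Green's formula is a passage to the limit in the
  definition of \<open>Hdiv_0\<close> for homogeneous boundary conditions; on the torus \<open>\<psi>\<close> is approximated by its
  projections onto trigonometric polynomials. The existence of \<open>tgrad_h\<close> also needs the linearity of the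
  weak divergence up to null sets, hence enough functions satisfying Green's formula to separate \<open>L2\<close>.
\<close>

text \<open>Functions stand for themselves rather than for classes, and \<open>wdiv\<close> is
  picked by Hilbert choice. So \<open>ip\<close> is only semidefinite, identities between
  divergences hold only almost everywhere, and exact equality is available only inside a broken
  space, where elements that agree almost everywhere coincide. The two settings differ in what
  \<open>V1\<close> supplies. For homogeneous conditions the approximation by test fields is built
  into \<open>Hdiv_0\<close>, and the field absorbs the boundary term, so it may be paired with
  functions that do not vanish on the boundary. Polynomials are such functions, and
  Stone-Weierstrass makes them dense. On the torus \<open>Hdiv\<close> contains no approximation, so
  the scalar factor is approximated instead. Closeness of functions says nothing about their
  gradients; a space stable under differentiation repairs this, since integration by parts shows
  that projecting commutes with differentiating. Projections being best approximations, both errors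
  are small once the space contains good approximants of \<psi> and of its gradient.\<close>

section \<open>Square integrable functions and their semidefinite inner product\<close>

definition ip :: "(real^2) set \<Rightarrow> (real^2 \<Rightarrow> 'b::euclidean_space) \<Rightarrow> (real^2 \<Rightarrow> 'b) \<Rightarrow> real" where
  "ip \<Omega> f g = integ \<Omega> (\<lambda>x. f x \<bullet> g x)"

lemma L2_measurable: "f \<in> L2 \<Omega> \<Longrightarrow> f \<in> borel_measurable (lebesgue_on \<Omega>)"
  by (simp add: L2_def)

lemma L2_integrable_inner:
  assumes "f \<in> L2 \<Omega>" "g \<in> L2 \<Omega>"
  shows "integrable (lebesgue_on \<Omega>) (\<lambda>x. f x \<bullet> g x)"
proof (rule Bochner_Integration.integrable_bound)
  show "integrable (lebesgue_on \<Omega>) (\<lambda>x. (norm (f x))\<^sup>2 + (norm (g x))\<^sup>2)"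
    using assms by (auto simp: L2_def)
  show "(\<lambda>x. f x \<bullet> g x) \<in> borel_measurable (lebesgue_on \<Omega>)"
    using assms by (auto simp: L2_def)
  have "\<bar>f x \<bullet> g x\<bar> \<le> (norm (f x))\<^sup>2 + (norm (g x))\<^sup>2" for x
  proof -
    have "\<bar>f x \<bullet> g x\<bar> \<le> norm (f x) * norm (g x)" by (rule Cauchy_Schwarz_ineq2)
    moreover have "norm (f x) * norm (g x) \<le> (norm (f x))\<^sup>2 + (norm (g x))\<^sup>2"
      using sum_squares_bound[of "norm (f x)" "norm (g x)"] mult_nonneg_nonneg[OF norm_ge_zero[of "f x"] norm_ge_zero[of "g x"]]
      by linarith
    ultimately show ?thesis by linarith
  qed
  then show "AE x in lebesgue_on \<Omega>. norm (f x \<bullet> g x) \<le> norm ((norm (f x))\<^sup>2 + (norm (g x))\<^sup>2)"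
    by auto
qed

lemma L2_scale: "f \<in> L2 \<Omega> \<Longrightarrow> (\<lambda>x. c *\<^sub>R f x) \<in> L2 \<Omega>"
  by (auto simp: L2_def power_mult_distrib)

lemma L2_add:
  assumes "f \<in> L2 \<Omega>" "g \<in> L2 \<Omega>"
  shows "(\<lambda>x. f x + g x) \<in> L2 \<Omega>"
proof -
  have "(\<lambda>x. (norm (f x + g x))\<^sup>2) = (\<lambda>x. (norm (f x))\<^sup>2 + 2 * (f x \<bullet> g x) + (norm (g x))\<^sup>2)"
    by (auto simp: power2_norm_eq_inner inner_add_left inner_add_right inner_commute)
  moreover have "integrable (lebesgue_on \<Omega>) \<dots>"
    using assms L2_integrable_inner[OF assms] by (auto simp: L2_def)
  ultimately show ?thesis using assms by (auto simp: L2_def)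
qed

lemma L2_diff: "f \<in> L2 \<Omega> \<Longrightarrow> g \<in> L2 \<Omega> \<Longrightarrow> (\<lambda>x. f x - g x) \<in> L2 \<Omega>"
  using L2_add[of f \<Omega> "\<lambda>x. (-1) *\<^sub>R g x"] L2_scale[of g \<Omega> "-1"] by simp

lemma L2_zero: "(\<lambda>x. 0) \<in> L2 \<Omega>"
  by (auto simp: L2_def)

lemma L2_component: "g \<in> L2 \<Omega> \<Longrightarrow> (\<lambda>x. g x $ i) \<in> L2 \<Omega>"
  for g :: "real^2 \<Rightarrow> real^2"
proof -
  assume g: "g \<in> L2 \<Omega>"
  have m: "(\<lambda>x. g x $ i) \<in> borel_measurable (lebesgue_on \<Omega>)"
    using borel_measurable_inner[OF L2_measurable[OF g] borel_measurable_const[of "axis i 1"]]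
    by (simp add: inner_axis)
  have "integrable (lebesgue_on \<Omega>) (\<lambda>x. (norm (g x $ i))\<^sup>2)"
  proof (rule Bochner_Integration.integrable_bound)
    show "integrable (lebesgue_on \<Omega>) (\<lambda>x. (norm (g x))\<^sup>2)" using g by (simp add: L2_def)
    show "(\<lambda>x. (norm (g x $ i))\<^sup>2) \<in> borel_measurable (lebesgue_on \<Omega>)" using m by measurable
    show "AE x in lebesgue_on \<Omega>. norm ((norm (g x $ i))\<^sup>2) \<le> norm ((norm (g x))\<^sup>2)"
      by (rule AE_I2) (simp add: component_le_norm_cart power_mono real_sqrt_le_iff flip: abs_le_square_iff)
  qed
  with m show ?thesis by (simp add: L2_def)
qed

lemma L2_vec:
  fixes g :: "real^2 \<Rightarrow> real^2"
  assumes "\<And>i. (\<lambda>x. g x $ i) \<in> L2 \<Omega>"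
  shows "g \<in> L2 \<Omega>"
proof -
  have "(\<lambda>x. g x $ i *\<^sub>R axis i (1::real)) \<in> borel_measurable (lebesgue_on \<Omega>)" for i :: 2
  proof (rule borel_measurable_scaleR)
    show "(\<lambda>x. g x $ i) \<in> borel_measurable (lebesgue_on \<Omega>)" by (rule L2_measurable[OF assms])
  qed simp
  then have "(\<lambda>x. \<Sum>i\<in>UNIV. g x $ i *\<^sub>R axis i (1::real)) \<in> borel_measurable (lebesgue_on \<Omega>)"
    by (rule borel_measurable_sum)
  moreover have "(\<lambda>x. \<Sum>i\<in>UNIV. g x $ i *\<^sub>R axis i 1) = g"
    by (rule ext) (metis scalar_mult_eq_scaleR basis_expansion)
  ultimately have m: "g \<in> borel_measurable (lebesgue_on \<Omega>)" by simp
  have "(\<lambda>x. (norm (g x))\<^sup>2) = (\<lambda>x. \<Sum>i\<in>UNIV. (norm (g x $ i))\<^sup>2)"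
    by (simp add: power2_norm_eq_inner inner_vec_def flip: power2_eq_square)
  moreover have "integrable (lebesgue_on \<Omega>) \<dots>"
    using assms by (auto simp: L2_def)
  ultimately show ?thesis using m by (simp add: L2_def)
qed

lemma ip_commute: "ip \<Omega> f g = ip \<Omega> g f"
  by (simp add: ip_def inner_commute)

lemma ip_add_left:
  "f \<in> L2 \<Omega> \<Longrightarrow> g \<in> L2 \<Omega> \<Longrightarrow> h \<in> L2 \<Omega> \<Longrightarrow> ip \<Omega> (\<lambda>x. f x + g x) h = ip \<Omega> f h + ip \<Omega> g h"
  by (simp add: ip_def inner_add_left L2_integrable_inner)

lemma ip_diff_left:
  "f \<in> L2 \<Omega> \<Longrightarrow> g \<in> L2 \<Omega> \<Longrightarrow> h \<in> L2 \<Omega> \<Longrightarrow> ip \<Omega> (\<lambda>x. f x - g x) h = ip \<Omega> f h - ip \<Omega> g h"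
  by (simp add: ip_def inner_diff_left L2_integrable_inner)

lemma ip_scale_left: "ip \<Omega> (\<lambda>x. c *\<^sub>R f x) h = c * ip \<Omega> f h"
  by (simp add: ip_def)

lemma ip_add_right:
  "f \<in> L2 \<Omega> \<Longrightarrow> g \<in> L2 \<Omega> \<Longrightarrow> h \<in> L2 \<Omega> \<Longrightarrow> ip \<Omega> h (\<lambda>x. f x + g x) = ip \<Omega> h f + ip \<Omega> h g"
  by (simp add: ip_def inner_add_right L2_integrable_inner)

lemma ip_diff_right:
  "f \<in> L2 \<Omega> \<Longrightarrow> g \<in> L2 \<Omega> \<Longrightarrow> h \<in> L2 \<Omega> \<Longrightarrow> ip \<Omega> h (\<lambda>x. f x - g x) = ip \<Omega> h f - ip \<Omega> h g"
  by (simp add: ip_def inner_diff_right L2_integrable_inner)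

lemma ip_scale_right: "ip \<Omega> h (\<lambda>x. c *\<^sub>R f x) = c * ip \<Omega> h f"
  by (simp add: ip_def)

lemma ip_cong_AE:
  assumes "f \<in> L2 \<Omega>" "f' \<in> L2 \<Omega>" "g \<in> L2 \<Omega>" "g' \<in> L2 \<Omega>" "ae_eq \<Omega> f f'" "ae_eq \<Omega> g g'"
  shows "ip \<Omega> f g = ip \<Omega> f' g'"
  unfolding ip_def
  by (rule integral_cong_AE) (use assms in \<open>auto dest!: L2_measurable\<close>)

lemma ip_self: "ip \<Omega> f f = integ \<Omega> (\<lambda>x. (norm (f x))\<^sup>2)"
  by (simp add: ip_def power2_norm_eq_inner)

lemma ip_self_nonneg: "0 \<le> ip \<Omega> f f"
  by (simp add: ip_def integral_nonneg_AE)

text \<open>The square of \<open>f + t g\<close> is a nonnegative quadratic in \<open>t\<close>. As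
  \<open>ip\<close> is only semidefinite, \<open>ip \<Omega> g g = 0\<close> does not give
  \<open>g = 0\<close>, and that case needs its own argument: an affine function bounded below has
  slope zero.\<close>

lemma ip_Cauchy_Schwarz:
  assumes f: "f \<in> L2 \<Omega>" and g: "g \<in> L2 \<Omega>"
  shows "(ip \<Omega> f g)\<^sup>2 \<le> ip \<Omega> f f * ip \<Omega> g g"
proof -
  define s where "s = ip \<Omega> f g"
  have q: "ip \<Omega> f f + 2 * t * s + t\<^sup>2 * ip \<Omega> g g \<ge> 0" for t
  proof -
    have "0 \<le> ip \<Omega> (\<lambda>x. f x + t *\<^sub>R g x) (\<lambda>x. f x + t *\<^sub>R g x)" by (rule ip_self_nonneg)
    also have "\<dots> = ip \<Omega> f f + 2 * t * s + t\<^sup>2 * ip \<Omega> g g"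
      using f g L2_scale[OF g, of t]
      by (simp add: ip_add_left ip_add_right L2_add ip_scale_left ip_scale_right s_def ip_commute[of \<Omega> g f] power2_eq_square algebra_simps)
    finally show ?thesis .
  qed
  show ?thesis
  proof (cases "ip \<Omega> g g = 0")
    case True
    have "s = 0"
    proof (rule ccontr)
      assume "s \<noteq> 0"
      \<comment> \<open>At this value of \<open>t\<close> the affine function equals -1.\<close>
      then have "2 * (- (ip \<Omega> f f + 1) / (2 * s)) * s = - (ip \<Omega> f f + 1)" by simp
      then show False using q[of "- (ip \<Omega> f f + 1) / (2 * s)"] unfolding True by linarith
    qed
    with True show ?thesis by (simp add: s_def)
  next
    case False
    then have pos: "ip \<Omega> g g > 0" using ip_self_nonneg[of \<Omega> g] by linarith
    have "ip \<Omega> f f - s\<^sup>2 / ip \<Omega> g g \<ge> 0"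
      using q[of "- s / ip \<Omega> g g"] pos by (simp add: power2_eq_square field_simps)
    with pos show ?thesis by (simp add: s_def field_simps)
  qed
qed

lemma ip_self_eq_0_iff:
  assumes "f \<in> L2 \<Omega>"
  shows "ip \<Omega> f f = 0 \<longleftrightarrow> ae_eq \<Omega> f (\<lambda>x. 0)"
proof -
  have "ip \<Omega> f f = 0 \<longleftrightarrow> (AE x in lebesgue_on \<Omega>. f x \<bullet> f x = 0)"
    unfolding ip_def by (rule integral_nonneg_eq_0_iff_AE) (use assms in \<open>auto intro: L2_integrable_inner\<close>)
  then show ?thesis by simp
qed

text \<open>The substitute for definiteness: a function with square zero is invisible to
  \<open>ip\<close>, even if it is not the zero function.\<close>

lemma ip_eq_0_if_null:
  assumes "f \<in> L2 \<Omega>" "g \<in> L2 \<Omega>" "ip \<Omega> f f = 0"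
  shows "ip \<Omega> f g = 0"
  using ip_Cauchy_Schwarz[OF assms(1,2)] assms(3) by simp

lemma ip_tendsto:
  assumes f: "\<And>n. f n \<in> L2 \<Omega>" "f' \<in> L2 \<Omega>" and g: "g \<in> L2 \<Omega>"
    and lim: "(\<lambda>n. integ \<Omega> (\<lambda>x. (norm (f n x - f' x))\<^sup>2)) \<longlonglongrightarrow> 0"
  shows "(\<lambda>n. ip \<Omega> (f n) g) \<longlonglongrightarrow> ip \<Omega> f' g"
proof -
  have "(\<lambda>n. sqrt (ip \<Omega> (\<lambda>x. f n x - f' x) (\<lambda>x. f n x - f' x) * ip \<Omega> g g)) \<longlonglongrightarrow> sqrt (0 * ip \<Omega> g g)"
    using lim by (intro tendsto_intros) (simp add: ip_self)
  then have lim0: "(\<lambda>n. sqrt (ip \<Omega> (\<lambda>x. f n x - f' x) (\<lambda>x. f n x - f' x) * ip \<Omega> g g)) \<longlonglongrightarrow> 0" by simp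
  have "\<bar>ip \<Omega> (f n) g - ip \<Omega> f' g\<bar> \<le> sqrt (ip \<Omega> (\<lambda>x. f n x - f' x) (\<lambda>x. f n x - f' x) * ip \<Omega> g g)" for n
  proof (rule real_le_rsqrt)
    show "\<bar>ip \<Omega> (f n) g - ip \<Omega> f' g\<bar>\<^sup>2
        \<le> ip \<Omega> (\<lambda>x. f n x - f' x) (\<lambda>x. f n x - f' x) * ip \<Omega> g g"
      using ip_Cauchy_Schwarz[OF L2_diff[OF f(1) f(2)] g, of n]
      unfolding ip_diff_left[OF f(1) f(2) g] power2_abs .
  qed
  then have "(\<lambda>n. ip \<Omega> (f n) g - ip \<Omega> f' g) \<longlonglongrightarrow> 0"
    by (intro Lim_null_comparison[OF _ lim0]) auto
  then show ?thesis using LIM_zero_iff by blast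
qed

section \<open>Finite-dimensional subspaces\<close>

text \<open>The linear span, built one generator at a time so that closure properties follow by rule
  induction. The generators may be linearly dependent, exactly or modulo null sets.\<close>

inductive_set lin :: "(real^2 \<Rightarrow> 'b::real_vector) set \<Rightarrow> (real^2 \<Rightarrow> 'b) set" for B where
  zero: "(\<lambda>x. 0) \<in> lin B"
| step: "b \<in> B \<Longrightarrow> f \<in> lin B \<Longrightarrow> (\<lambda>x. f x + c *\<^sub>R b x) \<in> lin B"

lemma lin_add: "f \<in> lin B \<Longrightarrow> g \<in> lin B \<Longrightarrow> (\<lambda>x. f x + g x) \<in> lin B"
proof (induction rule: lin.induct)
  case zero
  then show ?case by simp
next
  case (step b f c)
  have "(\<lambda>x. (f x + g x) + c *\<^sub>R b x) \<in> lin B"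
    using step by (intro lin.step) auto
  then show ?case by (simp add: add_ac)
qed

lemma lin_scale: "f \<in> lin B \<Longrightarrow> (\<lambda>x. a *\<^sub>R f x) \<in> lin B"
proof (induction rule: lin.induct)
  case zero
  then show ?case by (simp add: lin.zero)
next
  case (step b f c)
  have "(\<lambda>x. a *\<^sub>R f x + (a * c) *\<^sub>R b x) \<in> lin B"
    using step by (intro lin.step) auto
  then show ?case by (simp add: scaleR_add_right)
qed

lemma lin_diff: "f \<in> lin B \<Longrightarrow> g \<in> lin B \<Longrightarrow> (\<lambda>x. f x - g x) \<in> lin B"
  using lin_add[of f B "\<lambda>x. (-1) *\<^sub>R g x"] lin_scale[of g B "-1"] by simp

lemma lin_base: "b \<in> B \<Longrightarrow> b \<in> lin B"
  using lin.step[OF _ lin.zero, of b B 1] by simp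

lemma lin_sum: "(\<And>i. i \<in> I \<Longrightarrow> f i \<in> lin B) \<Longrightarrow> (\<lambda>x. \<Sum>i\<in>I. f i x) \<in> lin B"
  by (induction I rule: infinite_finite_induct) (auto intro: lin.zero lin_add)

lemma lin_subset:
  assumes "B \<subseteq> V" "(\<lambda>x. 0) \<in> V" "\<And>f g c. f \<in> V \<Longrightarrow> g \<in> V \<Longrightarrow> (\<lambda>x. f x + c *\<^sub>R g x) \<in> V"
  shows "lin B \<subseteq> V"
proof
  fix f assume "f \<in> lin B"
  then show "f \<in> V" by induction (use assms in auto)
qed

lemma lin_mono: "B \<subseteq> C \<Longrightarrow> lin B \<subseteq> lin C"
  by (rule lin_subset) (auto intro: lin_base lin.zero lin_add lin_scale)

lemma lin_L2: "B \<subseteq> L2 \<Omega> \<Longrightarrow> lin B \<subseteq> L2 \<Omega>"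
  by (rule lin_subset) (auto intro: L2_zero L2_add L2_scale)

lemma lin_insert:
  assumes "f \<in> lin (insert b B)"
  shows "\<exists>g\<in>lin B. \<exists>c. f = (\<lambda>x. g x + c *\<^sub>R b x)"
  using assms
proof induction
  case zero
  then show ?case using lin.zero by (intro bexI[of _ "\<lambda>x. 0"] exI[of _ 0]) auto
next
  case (step b' f c)
  then obtain g d where g: "g \<in> lin B" "f = (\<lambda>x. g x + d *\<^sub>R b x)" by blast
  show ?case
  proof (cases "b' = b")
    case True
    then show ?thesis using g by (intro bexI[of _ g] exI[of _ "d + c"]) (auto simp: scaleR_add_left)
  next
    case False
    then have "b' \<in> B" using step by auto
    then show ?thesis using g
      by (intro bexI[of _ "\<lambda>x. g x + c *\<^sub>R b' x"] exI[of _ d]) (auto intro: lin.step)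
  qed
qed

lemma finite_dimensional_lin:
  assumes "finite_dimensional V"
  obtains B where "finite B" "V = lin B"
proof -
  obtain B where B: "finite B" "V = {(\<lambda>x. \<Sum>b\<in>B. c b *\<^sub>R b x) |c. True}"
    using assms unfolding finite_dimensional_def by blast
  have "V \<subseteq> lin B" unfolding B(2) by clarify (rule lin_sum, rule lin_scale, rule lin_base)
  moreover have "lin B \<subseteq> V"
  proof
    fix f assume "f \<in> lin B"
    then show "f \<in> V"
    proof induction
      case zero
      show ?case unfolding B(2) by (rule CollectI) (rule exI[of _ "\<lambda>_. 0"], simp)
    next
      case (step b f c)
      then obtain d where d: "f = (\<lambda>x. \<Sum>b\<in>B. d b *\<^sub>R b x)" unfolding B(2) by auto
      have "(\<lambda>x. f x + c *\<^sub>R b x) = (\<lambda>x. \<Sum>b'\<in>B. (d b' + (if b' = b then c else 0)) *\<^sub>R b' x)"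
      proof
        fix x
        have "(\<Sum>b'\<in>B. (if b' = b then c else 0) *\<^sub>R b' x) = c *\<^sub>R b x"
          unfolding sum.remove[OF B(1) step(1)] by (simp add: sum.neutral)
        then show "f x + c *\<^sub>R b x = (\<Sum>b'\<in>B. (d b' + (if b' = b then c else 0)) *\<^sub>R b' x)"
          unfolding d scaleR_add_left sum.distrib by simp
      qed
      then show ?case unfolding B(2)
        by (intro CollectI exI[of _ "\<lambda>b'. d b' + (if b' = b then c else 0)"] conjI TrueI)
    qed
  qed
  ultimately show thesis using that B(1) by blast
qed

text \<open>Gram--Schmidt: in each step the component of the new generator orthogonal to the old ones is either
  null, where \<open>l\<close> vanishes by assumption, or can be used to adjust the representing element.\<close>

lemma Riesz_lin:
  assumes "finite B" "B \<subseteq> L2 \<Omega>"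
    and "\<And>f g c. f \<in> lin B \<Longrightarrow> g \<in> lin B \<Longrightarrow> l (\<lambda>x. f x + c *\<^sub>R g x) = l f + c * l g"
    and "\<And>f. f \<in> lin B \<Longrightarrow> ip \<Omega> f f = 0 \<Longrightarrow> l f = 0"
  shows "\<exists>g\<in>lin B. \<forall>v\<in>lin B. ip \<Omega> g v = l v"
  using assms
proof (induction B arbitrary: l rule: finite_induct)
  case empty
  have "v = (\<lambda>x. 0)" if "v \<in> lin {}" for v :: "real^2 \<Rightarrow> 'a" using that by induction auto
  then have "ip \<Omega> v v = 0" if "v \<in> lin {}" for v :: "real^2 \<Rightarrow> 'a"
    using that by (fastforce simp: ip_def)
  then have "l v = 0" if "v \<in> lin {}" for v
    using empty(3) that by blast
  then have "\<forall>v\<in>lin {}. ip \<Omega> (\<lambda>x. 0) v = l v" by (simp add: ip_def)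
  then show ?case by (rule bexI[OF _ lin.zero])
next
  case (insert b B)
  have BL: "B \<subseteq> L2 \<Omega>" "b \<in> L2 \<Omega>" using insert.prems(1) by auto
  have sub: "lin B \<subseteq> lin (insert b B)" by (rule lin_mono) auto
  have linL: "f \<in> L2 \<Omega>" if "f \<in> lin B" for f using lin_L2[OF BL(1)] that by blast
  \<comment> \<open>The induction hypothesis is general in the functional and serves twice: here for
    \<open>ip \<Omega> b\<close>, giving the projection \<open>b0\<close> of the new generator, and
    below for \<open>l\<close> itself.\<close>
  have "\<exists>g\<in>lin B. \<forall>v\<in>lin B. ip \<Omega> g v = ip \<Omega> b v"
  proof (rule insert.IH)
    show "B \<subseteq> L2 \<Omega>" by (rule BL)
    show "ip \<Omega> b (\<lambda>x. f x + c *\<^sub>R g x) = ip \<Omega> b f + c * ip \<Omega> b g" if "f \<in> lin B" "g \<in> lin B" for f g c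
      using that BL linL by (simp add: ip_add_right ip_scale_right L2_scale)
    show "ip \<Omega> b f = 0" if "f \<in> lin B" "ip \<Omega> f f = 0" for f
      using that BL linL ip_eq_0_if_null[of f \<Omega> b] by (simp add: ip_commute)
  qed
  then obtain b0 where b0: "b0 \<in> lin B" "\<And>v. v \<in> lin B \<Longrightarrow> ip \<Omega> b0 v = ip \<Omega> b v" by blast
  have "\<exists>g\<in>lin B. \<forall>v\<in>lin B. ip \<Omega> g v = l v"
  proof (rule insert.IH)
    show "B \<subseteq> L2 \<Omega>" by (rule BL)
    show "l (\<lambda>x. f x + c *\<^sub>R g x) = l f + c * l g" if "f \<in> lin B" "g \<in> lin B" for f g c
      by (rule insert.prems(2)) (use that sub in auto)
    show "l f = 0" if "f \<in> lin B" "ip \<Omega> f f = 0" for f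
      by (rule insert.prems(3)) (use that sub in auto)
  qed
  then obtain g0 where g0: "g0 \<in> lin B" "\<And>v. v \<in> lin B \<Longrightarrow> ip \<Omega> g0 v = l v" by blast
  define b' where "b' = (\<lambda>x. b x - b0 x)"
  have b'L: "b' \<in> L2 \<Omega>" unfolding b'_def using BL b0 linL by (intro L2_diff) auto
  have b'_orth: "ip \<Omega> b' v = 0" if "v \<in> lin B" for v
    unfolding b'_def using that BL b0 linL by (simp add: ip_diff_left)
  have b'lin: "b' \<in> lin (insert b B)"
    unfolding b'_def by (rule lin_diff[OF lin_base]) (use sub b0(1) in auto)
  have split: "\<exists>w\<in>lin B. \<exists>c. v = (\<lambda>x. w x + c *\<^sub>R b' x)" if v: "v \<in> lin (insert b B)" for v
  proof -
    obtain w c where w: "w \<in> lin B" "v = (\<lambda>x. w x + c *\<^sub>R b x)" using lin_insert[OF v] by (elim bexE exE) (rule that)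
    show ?thesis
    proof (intro bexI exI)
      show "(\<lambda>x. w x + c *\<^sub>R b0 x) \<in> lin B" using w(1) lin_scale[OF b0(1)] by (rule lin_add)
      show "v = (\<lambda>x. (w x + c *\<^sub>R b0 x) + c *\<^sub>R b' x)"
        unfolding w(2) b'_def by (simp add: scaleR_diff_right)
    qed
  qed
  define d where "d = (if ip \<Omega> b' b' = 0 then 0 else l b' / ip \<Omega> b' b')"
  have d: "d * ip \<Omega> b' b' = l b'"
    using insert.prems(3)[OF b'lin] by (simp add: d_def)
  define g where "g = (\<lambda>x. g0 x + d *\<^sub>R b' x)"
  have "g \<in> lin (insert b B)"
    unfolding g_def using g0 sub b'lin by (intro lin_add lin_scale) auto
  moreover have "ip \<Omega> g v = l v" if v: "v \<in> lin (insert b B)" for v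
  proof -
    obtain w c where w: "w \<in> lin B" "v = (\<lambda>x. w x + c *\<^sub>R b' x)" using split[OF v] by (elim bexE exE) (rule that)
    have "l v = l w + c * l b'"
      unfolding w(2) using w(1) sub b'lin by (intro insert.prems(2)) auto
    moreover have "ip \<Omega> g v = ip \<Omega> g0 w + c * ip \<Omega> g0 b' + d * ip \<Omega> b' w + c * (d * ip \<Omega> b' b')"
      unfolding g_def w(2) using b'L linL w(1) g0(1)
      by (simp add: ip_add_left ip_add_right ip_scale_left ip_scale_right L2_add L2_scale algebra_simps)
    ultimately show ?thesis
      using g0(2)[OF w(1)] b'_orth[OF w(1)] b'_orth[OF g0(1)] d by (simp add: ip_commute[of \<Omega> g0 b'])
  qed
  ultimately show ?case by blast
qed

lemma projection_lin:
  assumes "finite B" "B \<subseteq> L2 \<Omega>" "f \<in> L2 \<Omega>"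
  shows "\<exists>p\<in>lin B. \<forall>v\<in>lin B. ip \<Omega> p v = ip \<Omega> f v"
proof (rule Riesz_lin[OF assms(1,2)])
  have L: "g \<in> L2 \<Omega>" if "g \<in> lin B" for g using lin_L2[OF assms(2)] that by blast
  show "ip \<Omega> f (\<lambda>x. g x + c *\<^sub>R h x) = ip \<Omega> f g + c * ip \<Omega> f h" if "g \<in> lin B" "h \<in> lin B" for g h c
    using that assms(3) L by (simp add: ip_add_right ip_scale_right L2_scale)
  show "ip \<Omega> f g = 0" if "g \<in> lin B" "ip \<Omega> g g = 0" for g
    using that assms(3) L ip_eq_0_if_null[of g \<Omega> f] by (simp add: ip_commute)
qed

text \<open>Pythagoras: \<open>f - q\<close> is the sum of \<open>f - p\<close>, which is orthogonal
  to the span, and of \<open>p - q\<close>, which lies in it.\<close>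

lemma best_approximation:
  assumes B: "B \<subseteq> L2 \<Omega>" and f: "f \<in> L2 \<Omega>"
    and p: "p \<in> lin B" "\<And>v. v \<in> lin B \<Longrightarrow> ip \<Omega> p v = ip \<Omega> f v" and q: "q \<in> lin B"
  shows "ip \<Omega> (\<lambda>x. f x - p x) (\<lambda>x. f x - p x) \<le> ip \<Omega> (\<lambda>x. f x - q x) (\<lambda>x. f x - q x)"
proof -
  have L: "g \<in> L2 \<Omega>" if "g \<in> lin B" for g using lin_L2[OF B] that by blast
  define r where "r = (\<lambda>x. p x - q x)"
  have r: "r \<in> lin B" unfolding r_def using p(1) q by (rule lin_diff)
  have o: "ip \<Omega> (\<lambda>x. f x - p x) r = 0"
    using p r L f by (simp add: ip_diff_left)
  have "(\<lambda>x. f x - q x) = (\<lambda>x. (f x - p x) + r x)" by (auto simp: r_def)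
  then have "ip \<Omega> (\<lambda>x. f x - q x) (\<lambda>x. f x - q x)
      = ip \<Omega> (\<lambda>x. f x - p x) (\<lambda>x. f x - p x) + 2 * ip \<Omega> (\<lambda>x. f x - p x) r + ip \<Omega> r r"
    using f L r p(1) by (simp add: ip_add_left ip_add_right L2_add L2_diff ip_commute[of \<Omega> r "\<lambda>x. f x - p x"])
  then show ?thesis using o ip_self_nonneg[of \<Omega> r] by simp
qed

section \<open>Density in the space of square integrable functions\<close>

lemma L2_dominated:
  assumes f: "f \<in> borel_measurable (lebesgue_on \<Omega>)" and g: "g \<in> L2 \<Omega>"
    and le: "\<And>x. x \<in> space (lebesgue_on \<Omega>) \<Longrightarrow> norm (f x) \<le> norm (g x)"
  shows "f \<in> L2 \<Omega>"
proof -
  have "integrable (lebesgue_on \<Omega>) (\<lambda>x. (norm (f x))\<^sup>2)"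
  proof (rule Bochner_Integration.integrable_bound)
    show "integrable (lebesgue_on \<Omega>) (\<lambda>x. (norm (g x))\<^sup>2)" using g by (simp add: L2_def)
    show "(\<lambda>x. (norm (f x))\<^sup>2) \<in> borel_measurable (lebesgue_on \<Omega>)" using f by measurable
    show "AE x in lebesgue_on \<Omega>. norm ((norm (f x))\<^sup>2) \<le> norm ((norm (g x))\<^sup>2)"
      by (rule AE_I2) (use le in \<open>auto intro: power_mono\<close>)
  qed
  with f show ?thesis by (simp add: L2_def)
qed

lemma open_sets_lebesgue: "open \<Omega> \<Longrightarrow> \<Omega> \<in> sets lebesgue"
  by (simp add: borel_open)

lemma finite_measure_lebesgue_on_open:
  assumes "open \<Omega>" "bounded \<Omega>"
  shows "finite_measure (lebesgue_on \<Omega>)"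
  using lmeasurable_open[OF assms(2,1)] by (rule finite_measure_lebesgue_on)

lemma L2_const: "open \<Omega> \<Longrightarrow> bounded \<Omega> \<Longrightarrow> (\<lambda>x. c) \<in> L2 \<Omega>"
  using finite_measure.integrable_const[OF finite_measure_lebesgue_on_open] by (auto simp: L2_def)

lemma L2_bounded:
  assumes \<Omega>: "open \<Omega>" "bounded \<Omega>" and "f \<in> borel_measurable (lebesgue_on \<Omega>)"
    and "\<And>x. x \<in> \<Omega> \<Longrightarrow> norm (f x) \<le> C"
  shows "f \<in> L2 \<Omega>"
  by (rule L2_dominated[OF assms(3) L2_const[OF \<Omega>, of "C :: real"]])
    (use assms(4) in \<open>force simp: space_restrict_space\<close>)

lemma L2_continuous:
  assumes \<Omega>: "open \<Omega>" "bounded \<Omega>" and f: "continuous_on UNIV f"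
  shows "f \<in> L2 \<Omega>"
proof -
  have "bounded (f ` closure \<Omega>)"
    using \<Omega> by (intro compact_imp_bounded compact_continuous_image continuous_on_subset[OF f]) auto
  then obtain C where "\<And>x. x \<in> closure \<Omega> \<Longrightarrow> norm (f x) \<le> C" by (auto simp: bounded_iff)
  then have "\<And>x. x \<in> \<Omega> \<Longrightarrow> norm (f x) \<le> C" using closure_subset by blast
  moreover have "f \<in> borel_measurable (lebesgue_on \<Omega>)"
    by (rule continuous_imp_measurable_on_sets_lebesgue)
      (use \<Omega> in \<open>auto intro: continuous_on_subset[OF f] open_sets_lebesgue\<close>)
  ultimately show ?thesis using \<Omega> by (intro L2_bounded)
qed

text \<open>A triangle inequality for squared distances, which avoids square roots at the price of
  the factors 2. They are the reason why the density arguments start from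
  \<open>e / 4\<close>.\<close>

lemma ip_diff_triangle:
  assumes "f \<in> L2 \<Omega>" "g \<in> L2 \<Omega>" "h \<in> L2 \<Omega>"
  shows "ip \<Omega> (\<lambda>x. f x - h x) (\<lambda>x. f x - h x)
    \<le> 2 * ip \<Omega> (\<lambda>x. f x - g x) (\<lambda>x. f x - g x) + 2 * ip \<Omega> (\<lambda>x. g x - h x) (\<lambda>x. g x - h x)"
proof -
  define a where "a = (\<lambda>x. f x - g x)"
  define b where "b = (\<lambda>x. g x - h x)"
  have L: "a \<in> L2 \<Omega>" "b \<in> L2 \<Omega>" using assms by (auto simp: a_def b_def intro: L2_diff)
  have *: "(\<lambda>x. f x - h x) = (\<lambda>x. a x + b x)" by (auto simp: a_def b_def)
  have "0 \<le> ip \<Omega> (\<lambda>x. a x - b x) (\<lambda>x. a x - b x)" by (rule ip_self_nonneg)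
  then have "2 * ip \<Omega> a b \<le> ip \<Omega> a a + ip \<Omega> b b"
    using L by (simp add: ip_diff_left ip_diff_right L2_diff ip_commute[of \<Omega> b a])
  then show ?thesis
    unfolding * a_def[symmetric] b_def[symmetric]
    using L by (simp add: ip_add_left ip_add_right L2_add ip_commute[of \<Omega> b a])
qed

text \<open>Membership in the mean square closure of \<open>D\<close>. Intersecting with
  \<open>L2\<close> lets \<open>D\<close> be described without regard to integrability.\<close>

definition approximable :: "(real^2) set \<Rightarrow> (real^2 \<Rightarrow> real) set \<Rightarrow> (real^2 \<Rightarrow> real) \<Rightarrow> bool" where
  "approximable \<Omega> D f \<longleftrightarrow> (\<forall>e>0. \<exists>p\<in>D \<inter> L2 \<Omega>. ip \<Omega> (\<lambda>x. f x - p x) (\<lambda>x. f x - p x) < e)"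

lemma approximable_trans:
  assumes f: "f \<in> L2 \<Omega>"
    and "\<And>e. e > 0 \<Longrightarrow> \<exists>g\<in>L2 \<Omega>. approximable \<Omega> D g \<and> ip \<Omega> (\<lambda>x. f x - g x) (\<lambda>x. f x - g x) < e"
  shows "approximable \<Omega> D f"
  unfolding approximable_def
proof (intro allI impI)
  fix e :: real assume "e > 0"
  then obtain g where g: "g \<in> L2 \<Omega>" "approximable \<Omega> D g" "ip \<Omega> (\<lambda>x. f x - g x) (\<lambda>x. f x - g x) < e / 4"
    using assms(2)[of "e / 4"] by auto
  obtain p where p: "p \<in> D \<inter> L2 \<Omega>" "ip \<Omega> (\<lambda>x. g x - p x) (\<lambda>x. g x - p x) < e / 4"
    using g(2) \<open>e > 0\<close> unfolding approximable_def by (meson divide_pos_pos zero_less_numeral)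
  have "ip \<Omega> (\<lambda>x. f x - p x) (\<lambda>x. f x - p x) < e"
    using ip_diff_triangle[OF f g(1), of p] p g(3) by auto
  with p show "\<exists>p\<in>D \<inter> L2 \<Omega>. ip \<Omega> (\<lambda>x. f x - p x) (\<lambda>x. f x - p x) < e" by blast
qed

lemma approximable_scale:
  assumes D: "\<And>p c. p \<in> D \<Longrightarrow> (\<lambda>x. c * p x) \<in> D" and "approximable \<Omega> D f"
  shows "approximable \<Omega> D (\<lambda>x. c * f x)"
  unfolding approximable_def
proof (intro allI impI)
  fix e :: real assume e: "e > 0"
  \<comment> \<open>The summand 1 covers \<open>c = 0\<close> and makes
    \<open>c\<^sup>2 * d < e\<close> strict.\<close>
  define d where "d = e / (c\<^sup>2 + 1)"
  have c: "c\<^sup>2 + 1 > 0" by (simp add: add_nonneg_pos)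
  then have d: "d > 0" using e by (simp add: d_def)
  obtain p where p: "p \<in> D \<inter> L2 \<Omega>" "ip \<Omega> (\<lambda>x. f x - p x) (\<lambda>x. f x - p x) < d"
    using assms(2) d unfolding approximable_def by blast
  have "ip \<Omega> (\<lambda>x. c * f x - c * p x) (\<lambda>x. c * f x - c * p x)
      = c * (c * ip \<Omega> (\<lambda>x. f x - p x) (\<lambda>x. f x - p x))"
    using ip_scale_left[of \<Omega> c "\<lambda>x. f x - p x"] ip_scale_right[of \<Omega> _ c "\<lambda>x. f x - p x"]
    by (simp add: right_diff_distrib)
  also have "\<dots> \<le> c\<^sup>2 * d"
    using p(2) by (simp add: power2_eq_square mult.assoc[symmetric] mult_left_mono)
  also have "\<dots> < e" using c e by (simp add: d_def field_simps)
  finally show "\<exists>p\<in>D \<inter> L2 \<Omega>. ip \<Omega> (\<lambda>x. c * f x - p x) (\<lambda>x. c * f x - p x) < e"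
    using p(1) D[of p c] L2_scale[of p \<Omega> c] by (intro bexI[of _ "\<lambda>x. c * p x"]) auto
qed

lemma approximable_add:
  assumes D: "\<And>p q. p \<in> D \<Longrightarrow> q \<in> D \<Longrightarrow> (\<lambda>x. p x + q x) \<in> D"
    and "approximable \<Omega> D f" "approximable \<Omega> D g" "f \<in> L2 \<Omega>" "g \<in> L2 \<Omega>"
  shows "approximable \<Omega> D (\<lambda>x. f x + g x)"
  unfolding approximable_def
proof (intro allI impI)
  fix e :: real assume "e > 0"
  then have "e / 4 > 0" by simp
  then obtain p q where p: "p \<in> D \<inter> L2 \<Omega>" "ip \<Omega> (\<lambda>x. f x - p x) (\<lambda>x. f x - p x) < e / 4"
    and q: "q \<in> D \<inter> L2 \<Omega>" "ip \<Omega> (\<lambda>x. g x - q x) (\<lambda>x. g x - q x) < e / 4"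
    using assms(2,3) unfolding approximable_def by meson
  \<comment> \<open>The error of the sum is written as a difference of the two errors, so that the
    triangle estimate applies with the zero function in the middle.\<close>
  have "(\<lambda>x. (f x + g x) - (p x + q x)) = (\<lambda>x. (f x - p x) - (q x - g x))" by auto
  moreover have "(\<lambda>x. q x - g x) = (\<lambda>x. - 1 * (g x - q x))" by auto
  ultimately have "ip \<Omega> (\<lambda>x. (f x + g x) - (p x + q x)) (\<lambda>x. (f x + g x) - (p x + q x)) < e"
    using ip_diff_triangle[of "\<lambda>x. f x - p x" \<Omega> "\<lambda>x. 0" "\<lambda>x. q x - g x"] p q assms(4,5)
    by (simp add: L2_diff L2_zero ip_def power2_commute[of "q _" "g _"] flip: power2_eq_square)
  with p q D show "\<exists>p\<in>D \<inter> L2 \<Omega>. ip \<Omega> (\<lambda>x. f x + g x - p x) (\<lambda>x. f x + g x - p x) < e"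
    by (intro bexI[of _ "\<lambda>x. p x + q x"]) (auto intro: L2_add)
qed

text \<open>Continuity on the whole plane allows Stone-Weierstrass on the closure of the domain;
  vanishing outside the cell is what later lets such a function descend to the torus.\<close>

definition compactly_supported :: "(real^2) set \<Rightarrow> (real^2 \<Rightarrow> real) set" where
  "compactly_supported \<Omega> =
     {h. continuous_on UNIV h \<and> (\<exists>K. compact K \<and> K \<subseteq> \<Omega> \<and> (\<forall>x. x \<notin> K \<longrightarrow> h x = 0))}"

lemma compactly_supported_add:
  assumes "p \<in> compactly_supported \<Omega>" "q \<in> compactly_supported \<Omega>"
  shows "(\<lambda>x. p x + q x) \<in> compactly_supported \<Omega>"
proof -
  obtain K L where "compact K" "K \<subseteq> \<Omega>" "\<forall>x. x \<notin> K \<longrightarrow> p x = 0" "compact L" "L \<subseteq> \<Omega>" "\<forall>x. x \<notin> L \<longrightarrow> q x = 0"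
    using assms by (auto simp: compactly_supported_def)
  then show ?thesis using assms
    by (auto simp: compactly_supported_def intro!: continuous_intros exI[of _ "K \<union> L"])
qed

lemma compactly_supported_scale: "p \<in> compactly_supported \<Omega> \<Longrightarrow> (\<lambda>x. c * p x) \<in> compactly_supported \<Omega>"
  by (auto simp: compactly_supported_def intro!: continuous_intros)

text \<open>\<open>A\<close> is replaced by a closed subset \<open>T\<close>, and \<open>T\<close>
  is enclosed in an open \<open>U\<close>. A continuous function that is 1 on \<open>T\<close> and 0
  off \<open>U\<close> differs from the indicator of \<open>A\<close> only on the two small sets
  \<open>A - T\<close> and \<open>U - T\<close>, and by at most 1 there.\<close>

lemma approximable_indicator:
  assumes \<Omega>: "open \<Omega>" "bounded \<Omega>" and A: "A \<in> sets (lebesgue_on \<Omega>)"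
  shows "approximable \<Omega> (compactly_supported \<Omega>) (indicator A)"
  unfolding approximable_def
proof (intro allI impI)
  fix e :: real assume "e > 0"
  have AL: "A \<subseteq> \<Omega>" "A \<in> sets lebesgue"
    using A \<Omega> by (auto simp: sets_restrict_space_iff open_sets_lebesgue)
  obtain T where T: "closed T" "T \<subseteq> A" "A - T \<in> lmeasurable" "emeasure lebesgue (A - T) < ennreal (e / 2)"
    using sets_lebesgue_inner_closed[OF AL(2), of "e / 2"] \<open>e > 0\<close> by auto
  obtain U where U: "open U" "T \<subseteq> U" "U - T \<in> lmeasurable" "emeasure lebesgue (U - T) < ennreal (e / 2)"
    using sets_lebesgue_outer_open[of T "e / 2"] T \<open>e > 0\<close> by auto
  define U' where "U' = U \<inter> \<Omega>"
  have U': "closed (- U')" "T \<inter> - U' = {}" using U T \<Omega> AL by (auto simp: U'_def open_Int)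
  obtain h :: "real^2 \<Rightarrow> real" where h: "continuous_on UNIV h" "\<And>x. h x \<in> closed_segment 1 0"
    "\<And>x. x \<in> T \<Longrightarrow> h x = 1" "\<And>x. x \<in> - U' \<Longrightarrow> h x = 0"
    using Urysohn[OF T(1) U', of 1 0] by blast
  \<comment> \<open>The set where \<open>h\<close> is nonzero may reach up to the boundary of
    \<open>\<Omega>\<close>. Cutting off at height 1/2 confines the support to the set where
    \<open>h\<close> is at least 1/2, which is closed, bounded and inside \<open>U'\<close>.\<close>
  define p where "p = (\<lambda>x. max 0 (2 * h x - 1))"
  have h01: "0 \<le> h x" "h x \<le> 1" for x using h(2)[of x] by (auto simp: closed_segment_eq_real_ivl)
  have pc: "continuous_on UNIV p" unfolding p_def by (intro continuous_intros h)
  have "compact {x. 1 / 2 \<le> h x}"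
  proof -
    have sub: "{x. 1 / 2 \<le> h x} \<subseteq> U'" using h(4) by force
    have "closed {x. 1 / 2 \<le> h x}" by (intro closed_Collect_le continuous_intros h)
    moreover have "bounded {x. 1 / 2 \<le> h x}" using sub \<Omega>(2) bounded_subset by (auto simp: U'_def)
    ultimately show ?thesis by (simp add: compact_eq_bounded_closed)
  qed
  moreover have "{x. 1 / 2 \<le> h x} \<subseteq> \<Omega>" using h(4) by (force simp: U'_def)
  ultimately have pD: "p \<in> compactly_supported \<Omega>"
    using pc by (auto simp: compactly_supported_def p_def intro!: exI[of _ "{x. 1 / 2 \<le> h x}"])
  have pL: "p \<in> L2 \<Omega>" using \<Omega> pc by (rule L2_continuous)
  have iL: "indicat_real A \<in> L2 \<Omega>"
    using A by (intro L2_bounded[OF \<Omega>, of _ 1]) (auto simp: indicator_def)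
  define M where "M = ((A - T) \<union> (U - T)) \<inter> \<Omega>"
  have M: "M \<in> lmeasurable"
    unfolding M_def using T(3) U(3) lmeasurable_open[OF \<Omega>(2,1)] by (intro fmeasurable.Int fmeasurable.Un) auto
  have Ms: "M \<in> sets (lebesgue_on \<Omega>)"
    using M \<Omega> by (auto simp: sets_restrict_space_iff open_sets_lebesgue M_def fmeasurableD)
  have pw: "(indicat_real A x - p x)\<^sup>2 \<le> indicat_real M x" if "x \<in> \<Omega>" for x
  proof -
    have "\<bar>indicat_real A x - p x\<bar> \<le> indicat_real M x"
      using that h01[of x] h(3)[of x] h(4)[of x] T(2) U(2)
      by (cases "x \<in> T"; cases "x \<in> U"; cases "x \<in> A")
        (auto simp: indicator_def M_def p_def U'_def max_def)
    then have "(indicat_real A x - p x)\<^sup>2 \<le> (indicat_real M x)\<^sup>2"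
      unfolding abs_le_square_iff[symmetric] by simp
    also have "\<dots> = indicat_real M x" by (simp add: indicator_def)
    finally show ?thesis .
  qed
  have "ip \<Omega> (\<lambda>x. indicat_real A x - p x) (\<lambda>x. indicat_real A x - p x) \<le> integ \<Omega> (indicat_real M)"
    unfolding ip_def
  proof (rule integral_mono)
    show "integrable (lebesgue_on \<Omega>) (\<lambda>x. (indicat_real A x - p x) \<bullet> (indicat_real A x - p x))"
      by (intro L2_integrable_inner L2_diff iL pL)
    show "integrable (lebesgue_on \<Omega>) (indicat_real M)"
      using finite_measure.emeasure_finite[OF finite_measure_lebesgue_on_open[OF \<Omega>]] Ms
      by (intro integrable_real_indicator) (auto simp: less_top)
  qed (use pw in \<open>auto simp: space_restrict_space power2_eq_square\<close>)
  also have "integ \<Omega> (indicat_real M) = measure lebesgue M"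
    using Ms \<Omega> by (simp add: measure_restrict_space open_sets_lebesgue M_def Int_absorb2)
  also have "\<dots> \<le> measure lebesgue ((A - T) \<union> (U - T))"
    by (rule measure_mono_fmeasurable) (use M T(3) U(3) in \<open>auto simp: M_def fmeasurableD\<close>)
  also have "\<dots> \<le> measure lebesgue (A - T) + measure lebesgue (U - T)"
    by (rule measure_Un_le) (use T(3) U(3) in \<open>auto simp: fmeasurableD\<close>)
  also have "\<dots> < e / 2 + e / 2"
    by (rule add_strict_mono) (use T(3,4) U(3,4) \<open>e > 0\<close> in \<open>auto simp: emeasure_eq_measure2 ennreal_less_iff\<close>)
  finally show "\<exists>p\<in>compactly_supported \<Omega> \<inter> L2 \<Omega>.
      ip \<Omega> (\<lambda>x. indicat_real A x - p x) (\<lambda>x. indicat_real A x - p x) < e"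
    using pD pL by auto
qed

text \<open>Induction over nonnegative measurable functions with square integrability as a premise.
  In each case the parts must be shown to inherit it: summands and members of an increasing sequence
  are dominated by the function itself. Increasing limits are handled by dominated convergence,
  signed functions by their positive and negative parts.\<close>

lemma approximable_compactly_supported:
  assumes \<Omega>: "open \<Omega>" "bounded \<Omega>" and f: "f \<in> L2 \<Omega>"
  shows "approximable \<Omega> (compactly_supported \<Omega>) f"
proof -
  have nonneg: "approximable \<Omega> (compactly_supported \<Omega>) u"
    if "u \<in> borel_measurable (lebesgue_on \<Omega>)" "\<And>x. 0 \<le> u x" "u \<in> L2 \<Omega>" for u
    using that
  proof (induction rule: borel_measurable_induct_real)
    case (set A)
    then show ?case by (intro approximable_indicator \<Omega>)
  next
    case (mult u c)
    show ?case
    \<comment> \<open>For \<open>c = 0\<close> the premise on \<open>c * u\<close> says nothing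
      about \<open>u\<close>, so the induction hypothesis is out of reach; the function is then the
      indicator of the empty set.\<close>
    proof (cases "c = 0")
      case True
      have "approximable \<Omega> (compactly_supported \<Omega>) (indicator {})"
        by (rule approximable_indicator[OF \<Omega>]) auto
      moreover have "indicat_real {} = (\<lambda>x. c * u x)" using True by auto
      ultimately show ?thesis by simp
    next
      case False
      then have "(\<lambda>x. inverse c *\<^sub>R (c * u x)) = u" by auto
      then have "u \<in> L2 \<Omega>" using L2_scale[OF mult.prems, of "inverse c"] by simp
      then show ?thesis using mult by (intro approximable_scale compactly_supported_scale) auto
    qed
  next
    case (add u v)
    have "u \<in> L2 \<Omega>" "v \<in> L2 \<Omega>"
      using add.hyps by (auto intro!: L2_dominated[OF _ add.prems] simp: abs_of_nonneg add_nonneg_nonneg)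
    then show ?case using add by (intro approximable_add compactly_supported_add) auto
  next
    case (seq U)
    have lim: "(\<lambda>i. U i x) \<longlonglongrightarrow> u x" if "x \<in> space (lebesgue_on \<Omega>)" for x using seq.hyps that by blast
    have le: "0 \<le> U i x" "U i x \<le> u x" if "x \<in> space (lebesgue_on \<Omega>)" for i x
    proof -
      show "0 \<le> U i x" by (rule seq.hyps(2))
      have "incseq (\<lambda>i. U i x)" using seq.hyps by (auto simp: incseq_def le_fun_def)
      then show "U i x \<le> u x" by (rule incseq_le) (rule lim[OF that])
    qed
    have UL: "U i \<in> L2 \<Omega>" for i
    proof (rule L2_dominated[OF seq.hyps(1) seq.prems])
      fix x assume "x \<in> space (lebesgue_on \<Omega>)"
      from le[OF this, of i] show "norm (U i x) \<le> norm (u x)" by simp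
    qed
    have "(\<lambda>i. integ \<Omega> (\<lambda>x. (u x - U i x)\<^sup>2)) \<longlonglongrightarrow> integ \<Omega> (\<lambda>x. 0)"
    proof (rule integral_dominated_convergence)
      show "integrable (lebesgue_on \<Omega>) (\<lambda>x. (norm (u x))\<^sup>2)" using seq.prems by (simp add: L2_def)
      show "AE x in lebesgue_on \<Omega>. (\<lambda>i. (u x - U i x)\<^sup>2) \<longlonglongrightarrow> 0"
      proof (rule AE_I2)
        fix x assume "x \<in> space (lebesgue_on \<Omega>)"
        then have "(\<lambda>i. (u x - U i x)\<^sup>2) \<longlonglongrightarrow> (u x - u x)\<^sup>2" by (intro tendsto_intros lim)
        then show "(\<lambda>i. (u x - U i x)\<^sup>2) \<longlonglongrightarrow> 0" by simp
      qed
      show "AE x in lebesgue_on \<Omega>. norm ((u x - U i x)\<^sup>2) \<le> (norm (u x))\<^sup>2" for i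
        by (rule AE_I2) (use le in \<open>auto intro!: power_mono\<close>)
      show "(\<lambda>x. (u x - U i x)\<^sup>2) \<in> borel_measurable (lebesgue_on \<Omega>)" for i
        using UL[of i] seq.prems by (auto simp: L2_def)
    qed auto
    then have lim0: "(\<lambda>i. ip \<Omega> (\<lambda>x. u x - U i x) (\<lambda>x. u x - U i x)) \<longlonglongrightarrow> 0"
      by (simp add: ip_def power2_eq_square)
    show ?case
    proof (rule approximable_trans[OF seq.prems])
      fix e :: real assume "e > 0"
      then have "\<forall>\<^sub>F i in sequentially. ip \<Omega> (\<lambda>x. u x - U i x) (\<lambda>x. u x - U i x) < e"
        using lim0 order_tendstoD(2) by blast
      then obtain i where "ip \<Omega> (\<lambda>x. u x - U i x) (\<lambda>x. u x - U i x) < e"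
        by (auto simp: eventually_sequentially)
      then show "\<exists>g\<in>L2 \<Omega>. approximable \<Omega> (compactly_supported \<Omega>) g
          \<and> ip \<Omega> (\<lambda>x. u x - g x) (\<lambda>x. u x - g x) < e"
        using UL seq.IH by blast
    qed
  qed
  define f1 where "f1 = (\<lambda>x. max 0 (f x))"
  define f2 where "f2 = (\<lambda>x. max 0 (- f x))"
  have m: "f1 \<in> borel_measurable (lebesgue_on \<Omega>)" "f2 \<in> borel_measurable (lebesgue_on \<Omega>)"
    using L2_measurable[OF f] unfolding f1_def f2_def by measurable
  have L: "f1 \<in> L2 \<Omega>" "f2 \<in> L2 \<Omega>"
    by (rule L2_dominated[OF _ f]; use m in \<open>auto simp: f1_def f2_def\<close>)+
  have "approximable \<Omega> (compactly_supported \<Omega>) (\<lambda>x. f1 x + (- 1) * f2 x)"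
    using L m L2_scale[OF L(2), of "-1"]
    by (intro approximable_add approximable_scale nonneg compactly_supported_add compactly_supported_scale)
      (auto simp: f1_def f2_def)
  moreover have "(\<lambda>x. f1 x + (- 1) * f2 x) = f" by (auto simp: f1_def f2_def)
  ultimately show ?thesis by simp
qed

text \<open>On a set of finite measure a uniform error \<open>c\<close> costs at most
  \<open>c\<^sup>2\<close> times the measure in mean square.\<close>

lemma approximable_uniform:
  assumes \<Omega>: "open \<Omega>" "bounded \<Omega>" and f: "f \<in> L2 \<Omega>"
    and D: "\<And>h e. h \<in> compactly_supported \<Omega> \<Longrightarrow> e > 0 \<Longrightarrow> \<exists>p\<in>D. continuous_on UNIV p \<and> (\<forall>x\<in>\<Omega>. \<bar>h x - p x\<bar> < e)"
  shows "approximable \<Omega> D f"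
proof (rule approximable_trans[OF f])
  fix e :: real assume "e > 0"
  then obtain h where h: "h \<in> compactly_supported \<Omega> \<inter> L2 \<Omega>" "ip \<Omega> (\<lambda>x. f x - h x) (\<lambda>x. f x - h x) < e"
    using approximable_compactly_supported[OF \<Omega> f] unfolding approximable_def by blast
  have "approximable \<Omega> D h"
    unfolding approximable_def
  proof (intro allI impI)
    fix d :: real assume "d > 0"
    define m where "m = measure lebesgue \<Omega>"
    \<comment> \<open>The summand 1 keeps the quotient meaningful when \<open>m = 0\<close>.\<close>
    define c where "c = sqrt (d / (m + 1))"
    have m: "m \<ge> 0" by (simp add: m_def)
    have c: "c > 0" "c\<^sup>2 * m < d" using \<open>d > 0\<close> m by (auto simp: c_def field_simps add_nonneg_pos)
    obtain p where p: "p \<in> D" "continuous_on UNIV p" "\<forall>x\<in>\<Omega>. \<bar>h x - p x\<bar> < c" using D[of h c] h c by auto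
    have pL: "p \<in> L2 \<Omega>" using L2_continuous[OF \<Omega> p(2)] .
    have "ip \<Omega> (\<lambda>x. h x - p x) (\<lambda>x. h x - p x) \<le> integ \<Omega> (\<lambda>x. c\<^sup>2)"
      unfolding ip_def
    proof (rule integral_mono)
      show "integrable (lebesgue_on \<Omega>) (\<lambda>x. (h x - p x) \<bullet> (h x - p x))"
        using h pL by (intro L2_integrable_inner L2_diff) auto
      show "integrable (lebesgue_on \<Omega>) (\<lambda>x. c\<^sup>2)"
        using finite_measure.integrable_const[OF finite_measure_lebesgue_on_open[OF \<Omega>]] .
      fix x assume "x \<in> space (lebesgue_on \<Omega>)"
      then have "\<bar>h x - p x\<bar> \<le> \<bar>c\<bar>" using p(3) by (force simp: space_restrict_space)
      then show "(h x - p x) \<bullet> (h x - p x) \<le> c\<^sup>2"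
        by (simp add: abs_le_square_iff flip: power2_eq_square)
    qed
    also have "\<dots> = c\<^sup>2 * m"
      using \<Omega> by (simp add: m_def measure_restrict_space space_restrict_space open_sets_lebesgue)
    finally show "\<exists>p\<in>D \<inter> L2 \<Omega>. ip \<Omega> (\<lambda>x. h x - p x) (\<lambda>x. h x - p x) < d" using c p(1) pL by force
  qed
  then show "\<exists>g\<in>L2 \<Omega>. approximable \<Omega> D g \<and> ip \<Omega> (\<lambda>x. f x - g x) (\<lambda>x. f x - g x) < e" using h by auto
qed

text \<open>If \<open>f\<close> is orthogonal to \<open>p\<close>, the squared distance from
  \<open>f\<close> to \<open>p\<close> is at least the square of \<open>f\<close>, so
  \<open>f\<close> cannot be approximated unless it is null.\<close>

lemma orthogonal_to_dense:
  assumes f: "f \<in> L2 \<Omega>" and "approximable \<Omega> D f" and orth: "\<And>p. p \<in> D \<Longrightarrow> p \<in> L2 \<Omega> \<Longrightarrow> ip \<Omega> f p = 0"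
  shows "ip \<Omega> f f = 0"
proof (rule ccontr)
  assume "ip \<Omega> f f \<noteq> 0"
  then have "ip \<Omega> f f > 0" using ip_self_nonneg[of \<Omega> f] by linarith
  then obtain p where p: "p \<in> D \<inter> L2 \<Omega>" "ip \<Omega> (\<lambda>x. f x - p x) (\<lambda>x. f x - p x) < ip \<Omega> f f"
    using assms(2) unfolding approximable_def by blast
  have "ip \<Omega> (\<lambda>x. f x - p x) (\<lambda>x. f x - p x) = ip \<Omega> f f + ip \<Omega> p p"
    using p f orth[of p] by (simp add: ip_diff_left ip_diff_right L2_diff ip_commute[of \<Omega> p f])
  then show False using p(2) ip_self_nonneg[of \<Omega> p] by linarith
qed

section \<open>Integration by parts\<close>

lemma part_eqI: "(\<phi> has_derivative \<phi>') (at x) \<Longrightarrow> part i \<phi> x = \<phi>' (axis i 1)"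
  unfolding part_def using frechet_derivative_at by metis

lemma part_has_derivative:
  assumes "\<phi> differentiable_on UNIV"
  shows "((\<lambda>h. \<phi> (x + h *\<^sub>R axis i 1)) has_real_derivative part i \<phi> (x + h *\<^sub>R axis i 1)) (at h within S)"
proof -
  have d: "(\<phi> has_derivative frechet_derivative \<phi> (at (x + h *\<^sub>R axis i 1))) (at (x + h *\<^sub>R axis i 1))"
    using assms by (simp add: differentiable_on_def flip: frechet_derivative_works)
  have "((\<lambda>h. x + h *\<^sub>R axis i 1) has_derivative (\<lambda>k. k *\<^sub>R axis i 1)) (at h within S)"
    by (auto intro!: derivative_eq_intros)
  from has_derivative_compose[OF this d]
  have "((\<lambda>h. \<phi> (x + h *\<^sub>R axis i 1)) has_derivative
      (\<lambda>k. frechet_derivative \<phi> (at (x + h *\<^sub>R axis i 1)) (k *\<^sub>R axis i 1))) (at h within S)" .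
  moreover have "frechet_derivative \<phi> (at (x + h *\<^sub>R axis i 1)) (k *\<^sub>R axis i 1) = part i \<phi> (x + h *\<^sub>R axis i 1) * k" for k
    using linear_scale[OF has_derivative_linear[OF d]] by (simp add: part_def)
  ultimately show ?thesis by (simp add: has_field_derivative_def)
qed

lemma Ck_1_continuous: "Ck (Suc 0) \<phi> \<Longrightarrow> continuous_on UNIV \<phi>"
  by (simp add: differentiable_imp_continuous_on)

lemma differentiable_on_UNIV_D: "\<phi> differentiable_on UNIV \<Longrightarrow> (\<phi> has_derivative frechet_derivative \<phi> (at x)) (at x)"
  by (simp add: differentiable_on_def flip: frechet_derivative_works)

lemma part_const: "part i (\<lambda>x. c) = (\<lambda>x. 0)"
  by (rule ext) (simp add: part_eqI[OF has_derivative_const])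

lemma part_add:
  assumes "f differentiable_on UNIV" "g differentiable_on UNIV"
  shows "part i (\<lambda>x. f x + g x) = (\<lambda>x. part i f x + part i g x)"
  using part_eqI[OF has_derivative_add[OF assms[THEN differentiable_on_UNIV_D]]]
  by (auto simp: part_def)

lemma part_mult:
  assumes "f differentiable_on UNIV" "g differentiable_on UNIV"
  shows "part i (\<lambda>x. f x * g x) = (\<lambda>x. f x * part i g x + part i f x * g x)"
  using part_eqI[OF has_derivative_mult[OF assms[THEN differentiable_on_UNIV_D]]]
  by (auto simp: part_def)

lemma part_cmult:
  assumes "f differentiable_on UNIV"
  shows "part i (\<lambda>x. c * f x) = (\<lambda>x. c * part i f x)"
  using part_mult[OF differentiable_on_const assms, of i c] by (simp add: part_const)

lemma part_linear:
  assumes "bounded_linear f"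
  shows "part i f = (\<lambda>x. f (axis i 1))"
  using part_eqI[OF bounded_linear_imp_has_derivative[OF assms]] by auto

lemma Ck_1_mult: "Ck (Suc 0) f \<Longrightarrow> Ck (Suc 0) g \<Longrightarrow> Ck (Suc 0) (\<lambda>x. f x * g x)"
  by (auto simp: part_mult differentiable_imp_continuous_on intro!: differentiable_on_mult continuous_intros)

lemma Ck_1_add: "Ck (Suc 0) f \<Longrightarrow> Ck (Suc 0) g \<Longrightarrow> Ck (Suc 0) (\<lambda>x. f x + g x)"
  by (auto simp: part_add intro!: continuous_intros)

text \<open>The integral over the box of the translates of \<open>\<phi>\<close> in the direction \<open>i\<close> is constant: the part leaving the
  box through one face reenters through the other. The derivative at \<open>0\<close> gives the claim.\<close>

lemma integral_part_eq_0:
  fixes a b :: "real^2"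
  assumes \<phi>: "Ck (Suc 0) \<phi>" and d: "0 < \<delta>" "\<delta> \<le> b $ i - a $ i"
    and per: "\<And>x. a $ i \<le> x $ i \<Longrightarrow> x $ i \<le> a $ i + \<delta> \<Longrightarrow> \<phi> (x + (b $ i - a $ i) *\<^sub>R axis i 1) = \<phi> x"
  shows "integral (cbox a b) (part i \<phi>) = 0"
proof -
  define e :: "real^2" where "e = axis i 1"
  define L where "L = b $ i - a $ i"
  have e: "x \<bullet> e = x $ i" for x by (simp add: e_def inner_axis)
  have eB: "e \<in> Basis" by (simp add: e_def axis_in_Basis_iff)
  have ei: "e $ i = 1" "j \<noteq> i \<Longrightarrow> e $ j = 0" for j by (auto simp: e_def axis_def)
  have mem: "x \<in> cbox u v \<longleftrightarrow>
      u $ i \<le> x $ i \<and> x $ i \<le> v $ i \<and> (\<forall>j. j \<noteq> i \<longrightarrow> u $ j \<le> x $ j \<and> x $ j \<le> v $ j)" for x u v :: "real^2"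
  proof -
    have "(\<forall>j. P j) \<longleftrightarrow> P i \<and> (\<forall>j. j \<noteq> i \<longrightarrow> P j)" for P by auto
    from this[of "\<lambda>j. u $ j \<le> x $ j \<and> x $ j \<le> v $ j"] show ?thesis unfolding mem_box_cart by blast
  qed
  have c\<phi>: "continuous_on UNIV \<phi>" using \<phi> by (rule Ck_1_continuous)
  have int: "(\<lambda>x. \<phi> (x + c)) integrable_on cbox u v" for c u v
    by (rule integrable_continuous) (auto intro!: continuous_intros continuous_on_compose2[OF c\<phi>])
  have const: "integral (cbox a b) (\<lambda>x. \<phi> (x + h *\<^sub>R e)) = integral (cbox a b) \<phi>"
    if h: "h \<in> {0..\<delta>}" for h
  proof -
    have low: "cbox a b \<inter> {x. x \<bullet> e \<le> b $ i - h} = cbox a (b - h *\<^sub>R e)"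
      using h d by (auto simp: e mem ei L_def)
    have up: "cbox a b \<inter> {x. x \<bullet> e \<ge> b $ i - h} = cbox (a + (L - h) *\<^sub>R e) b"
      using h d by (auto simp: e mem ei L_def)
    have low': "cbox a b \<inter> {x. x \<bullet> e \<ge> a $ i + h} = cbox (a + h *\<^sub>R e) b"
      using h d by (auto simp: e mem ei L_def)
    have up': "cbox a b \<inter> {x. x \<bullet> e \<le> a $ i + h} = cbox a (b - (L - h) *\<^sub>R e)"
      using h d by (auto simp: e mem ei L_def)
    have "integral (cbox a b) (\<lambda>x. \<phi> (x + h *\<^sub>R e))
        = integral (cbox a (b - h *\<^sub>R e)) (\<lambda>x. \<phi> (x + h *\<^sub>R e))
          + integral (cbox (a + (L - h) *\<^sub>R e) b) (\<lambda>x. \<phi> (x + h *\<^sub>R e))"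
      using integral_split[OF int eB, of a b "h *\<^sub>R e" "b $ i - h"] by (simp add: low up)
    also have "integral (cbox a (b - h *\<^sub>R e)) (\<lambda>x. \<phi> (x + h *\<^sub>R e)) = integral (cbox (a + h *\<^sub>R e) b) \<phi>"
      using integral_shift_cbox[of "a + h *\<^sub>R e" "h *\<^sub>R e" b \<phi>] by simp
    also have "integral (cbox (a + (L - h) *\<^sub>R e) b) (\<lambda>x. \<phi> (x + h *\<^sub>R e))
        = integral (cbox a (b - (L - h) *\<^sub>R e)) (\<lambda>x. \<phi> (x + L *\<^sub>R e))"
      using integral_shift_cbox[of "a + (L - h) *\<^sub>R e" "(L - h) *\<^sub>R e" b "\<lambda>x. \<phi> (x + h *\<^sub>R e)"]
      by (simp add: algebra_simps)
    also have "\<dots> = integral (cbox a (b - (L - h) *\<^sub>R e)) \<phi>"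
    proof (rule integral_cong)
      fix x assume "x \<in> cbox a (b - (L - h) *\<^sub>R e)"
      then have "x \<in> cbox a b \<inter> {x. x \<bullet> e \<le> a $ i + h}" using up' by simp
      then have "a $ i \<le> x $ i" "x $ i \<le> a $ i + h" by (auto simp: mem_box_cart e)
      moreover from h have "h \<le> \<delta>" by simp
      ultimately show "\<phi> (x + L *\<^sub>R e) = \<phi> x"
        unfolding L_def e_def by (intro per) linarith+
    qed
    also have "integral (cbox (a + h *\<^sub>R e) b) \<phi> + integral (cbox a (b - (L - h) *\<^sub>R e)) \<phi> = integral (cbox a b) \<phi>"
      using integral_split[OF int[of 0] eB, of a b "a $ i + h"] by (simp add: low' up')
    finally show ?thesis .
  qed
  define G where "G = (\<lambda>h. integral (cbox a b) (\<lambda>x. \<phi> (x + h *\<^sub>R e)))"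
  \<comment> \<open>The derivative is one-sided, since the translates are controlled only for
    \<open>h\<close> between 0 and \<open>\<delta>\<close>.\<close>
  have "(G has_real_derivative integral (cbox a b) (\<lambda>x. part i \<phi> (x + 0 *\<^sub>R e))) (at 0 within {0..\<delta>})"
    unfolding G_def
  proof (rule leibniz_rule_field_derivative)
    show "((\<lambda>h. \<phi> (t + h *\<^sub>R e)) has_real_derivative part i \<phi> (t + h *\<^sub>R e)) (at h within {0..\<delta>})" for h t
      unfolding e_def by (rule part_has_derivative) (use \<phi> in simp)
    show "continuous_on ({0..\<delta>} \<times> cbox a b) (\<lambda>(h, x). part i \<phi> (x + h *\<^sub>R e))"
      unfolding split_beta
      by (rule continuous_on_compose2[of UNIV "part i \<phi>"]) (use \<phi> in \<open>auto intro!: continuous_intros\<close>)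
  qed (use d int in auto)
  then have "(G has_vector_derivative integral (cbox a b) (part i \<phi>)) (at 0 within {0..\<delta>})"
    by (simp add: has_real_derivative_iff_has_vector_derivative)
  moreover have "(G has_vector_derivative 0) (at 0 within {0..\<delta>})"
  proof (rule has_vector_derivative_transform)
    show "G h = integral (cbox a b) \<phi>" if "h \<in> {0..\<delta>}" for h
      unfolding G_def using that by (rule const)
  qed (use d in auto)
  ultimately show ?thesis
    using d by (intro vector_derivative_unique_within_closed_interval[of 0 \<delta> 0 G]) (simp_all del: Ck.simps)
qed

lemma continuous_integrable:
  fixes f :: "real^2 \<Rightarrow> real"
  assumes "open \<Omega>" "bounded \<Omega>" "continuous_on UNIV f"
  shows "integrable (lebesgue_on \<Omega>) f"
  using L2_integrable_inner[OF L2_continuous[OF assms] L2_const[OF assms(1,2), of 1]] by simp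

text \<open>Bridge from the Lebesgue integral over the open box to the integral over the closed one,
  in which the translation argument is carried out.\<close>

lemma integ_box:
  fixes f :: "real^2 \<Rightarrow> real"
  assumes "continuous_on UNIV f"
  shows "integ (box a b) f = integral (cbox a b) f"
  using lebesgue_integral_eq_integral[OF continuous_integrable[OF open_box bounded_box assms]]
  by (simp add: integral_open_interval)

lemma integ_mult_part_eq:
  assumes \<Omega>: "open \<Omega>" "bounded \<Omega>" and f: "Ck (Suc 0) f" and g: "Ck (Suc 0) g"
    and 0: "integ \<Omega> (part i (\<lambda>x. f x * g x)) = 0"
  shows "integ \<Omega> (\<lambda>x. f x * part i g x) = - integ \<Omega> (\<lambda>x. part i f x * g x)"
proof -
  have "integ \<Omega> (\<lambda>x. f x * part i g x + part i f x * g x)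
      = integ \<Omega> (\<lambda>x. f x * part i g x) + integ \<Omega> (\<lambda>x. part i f x * g x)"
    using f g Ck_1_continuous[OF f] Ck_1_continuous[OF g]
    by (intro Bochner_Integration.integral_add continuous_integrable[OF \<Omega>] continuous_intros) auto
  then show ?thesis using 0 f g by (simp add: part_mult)
qed

lemma integration_by_parts_periodic:
  assumes ab: "\<And>i. a $ i < b $ i" and f: "Ck (Suc 0) f" and g: "Ck (Suc 0) g"
    and per: "\<And>x i. f (x + axis i (b $ i - a $ i)) = f x" "\<And>x i. g (x + axis i (b $ i - a $ i)) = g x"
  shows "integ (box a b) (\<lambda>x. f x * part i g x) = - integ (box a b) (\<lambda>x. part i f x * g x)"
proof (rule integ_mult_part_eq[OF open_box bounded_box f g])
  have fg: "Ck (Suc 0) (\<lambda>x. f x * g x)" using f g by (rule Ck_1_mult)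
  have ax: "c *\<^sub>R axis i 1 = axis i c" for c :: real by (simp add: axis_def vec_eq_iff)
  have "integral (cbox a b) (part i (\<lambda>x. f x * g x)) = 0"
    by (rule integral_part_eq_0[OF fg, of "b $ i - a $ i"]) (use ab[of i] per in \<open>auto simp: ax\<close>)
  then show "integ (box a b) (part i (\<lambda>x. f x * g x)) = 0"
    using fg by (subst integ_box) auto
qed

lemma part_eq_0_outside:
  assumes K: "compact K" "\<And>x. x \<notin> K \<Longrightarrow> \<phi> x = 0" and "x \<notin> K"
  shows "part i \<phi> x = 0"
proof -
  have "(\<phi> has_derivative (\<lambda>_. 0)) (at x)"
    by (rule has_derivative_transform_within_open[of "\<lambda>_. 0" _ _ _ "- K"])
      (use assms in \<open>auto simp: compact_imp_closed\<close>)
  then show ?thesis by (simp add: part_eqI)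
qed

text \<open>The product vanishes off \<open>K\<close>, so the domain may be exchanged for a large
  box. Vanishing near the faces of that box counts as periodicity there.\<close>

lemma integration_by_parts_compact:
  assumes \<Omega>: "open \<Omega>" "bounded \<Omega>" and f: "Ck (Suc 0) f" and g: "Ck (Suc 0) g"
    and K: "compact K" "K \<subseteq> \<Omega>" "\<And>x. x \<notin> K \<Longrightarrow> g x = 0"
  shows "integ \<Omega> (\<lambda>x. f x * part i g x) = - integ \<Omega> (\<lambda>x. part i f x * g x)"
proof (rule integ_mult_part_eq[OF \<Omega> f g])
  define \<Phi> where "\<Phi> = (\<lambda>x. f x * g x)"
  have \<Phi>: "Ck (Suc 0) \<Phi>" unfolding \<Phi>_def using f g by (rule Ck_1_mult)
  obtain R where R: "\<And>x. x \<in> \<Omega> \<Longrightarrow> norm x \<le> R" "R > 0" using \<Omega>(2) by (auto simp: bounded_pos)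
  \<comment> \<open>The faces keep distance 1 from the slab in which \<open>\<Phi>\<close> can be
    nonzero.\<close>
  define a b :: "real^2" where "a = (\<chi> i. - R - 1)" and "b = (\<chi> i. R + 1)"
  have \<Phi>0: "\<Phi> x = 0" if "\<bar>x $ i\<bar> > R" for x
    using that R(1)[of x] component_le_norm_cart[of x i] K by (force simp: \<Phi>_def)
  have "integral (cbox a b) (part i \<Phi>) = 0"
  \<comment> \<open>Within 1/2 of the lower face, and on the translate of this layer at the upper
    face, the coordinate exceeds \<open>R\<close> in absolute value, so both sides of the
    periodicity condition are 0.\<close>
  proof (rule integral_part_eq_0[OF \<Phi>, of "1 / 2"])
    fix x :: "real^2" assume "a $ i \<le> x $ i" "x $ i \<le> a $ i + 1 / 2"
    then show "\<Phi> (x + (b $ i - a $ i) *\<^sub>R axis i 1) = \<Phi> x"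
      using R(2) by (subst (1 2) \<Phi>0) (auto simp: a_def b_def axis_def)
  qed (use R(2) in \<open>auto simp: a_def b_def\<close>)
  then have "integ (box a b) (part i \<Phi>) = 0" using \<Phi> by (subst integ_box) auto
  moreover have "integ \<Omega> (part i \<Phi>) = integ (box a b) (part i \<Phi>)"
  proof -
    have "K \<subseteq> box a b"
    proof
      fix x assume "x \<in> K"
      then have "norm x \<le> R" using R(1) K(2) by blast
      have "- R - 1 < x $ j \<and> x $ j < R + 1" for j
        using \<open>norm x \<le> R\<close> component_le_norm_cart[of x j] by linarith
      then show "x \<in> box a b" by (simp add: mem_box_cart a_def b_def)
    qed
    moreover have "part i \<Phi> x = 0" if "x \<notin> K" for x
      by (rule part_eq_0_outside[OF K(1) _ that]) (simp add: \<Phi>_def K(3))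
    ultimately have "(\<lambda>x. indicat_real \<Omega> x *\<^sub>R part i \<Phi> x) = (\<lambda>x. indicat_real (box a b) x *\<^sub>R part i \<Phi> x)"
      using K(2) by (force simp: indicator_def)
    then show ?thesis
      using \<Omega> by (simp add: integral_restrict_space open_sets_lebesgue)
  qed
  ultimately show "integ \<Omega> (part i (\<lambda>x. f x * g x)) = 0" by (simp add: \<Phi>_def)
qed

section \<open>Green's formula for conforming fields: homogeneous boundary conditions\<close>

lemma ip_vec:
  fixes g w :: "real^2 \<Rightarrow> real^2"
  assumes "g \<in> L2 \<Omega>" "w \<in> L2 \<Omega>"
  shows "ip \<Omega> g w = (\<Sum>i\<in>UNIV. ip \<Omega> (\<lambda>x. g x $ i) (\<lambda>x. w x $ i))"
  unfolding ip_def inner_vec_def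
  by (rule Bochner_Integration.integral_sum) (intro L2_integrable_inner L2_component assms)

lemma ip_sum_left:
  assumes "\<And>i. i \<in> I \<Longrightarrow> f i \<in> L2 \<Omega>" "g \<in> L2 \<Omega>"
  shows "ip \<Omega> (\<lambda>x. \<Sum>i\<in>I. f i x) g = (\<Sum>i\<in>I. ip \<Omega> (f i) g)"
  unfolding ip_def inner_sum_left
  by (rule Bochner_Integration.integral_sum) (intro L2_integrable_inner assms)

lemma smooth_Ck: "smooth \<phi> \<Longrightarrow> Ck k \<phi>"
  by (simp add: smooth_def)

lemma cgrad_L2:
  assumes "open \<Omega>" "bounded \<Omega>" "Ck (Suc 0) \<eta>"
  shows "cgrad \<eta> \<in> L2 \<Omega>"
proof (rule L2_vec)
  show "(\<lambda>x. cgrad \<eta> x $ i) \<in> L2 \<Omega>" for i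
    using L2_continuous[OF assms(1,2), of "part i \<eta>"] assms(3) by (simp add: cgrad_def)
qed

text \<open>The compact support of the test function removes the boundary term, whatever
  \<open>\<eta>\<close> does near the boundary.\<close>

lemma has_weak_grad_cgrad:
  assumes \<Omega>: "open \<Omega>" "bounded \<Omega>" and \<eta>: "Ck (Suc 0) \<eta>"
  shows "has_weak_grad (Homogeneous \<Omega>) \<eta> (cgrad \<eta>)"
  unfolding has_weak_grad_def
proof (intro conjI ballI allI)
  show "cgrad \<eta> \<in> L2 (dom2 (Homogeneous \<Omega>))" using cgrad_L2[OF assms] by simp
  fix \<phi> i assume "\<phi> \<in> test (Homogeneous \<Omega>)"
  then obtain K where "smooth \<phi>" "compact K" "K \<subseteq> \<Omega>" "\<forall>x. x \<notin> K \<longrightarrow> \<phi> x = 0" by auto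
  then show "integ (dom2 (Homogeneous \<Omega>)) (\<lambda>x. \<eta> x * part i \<phi> x)
      = - integ (dom2 (Homogeneous \<Omega>)) (\<lambda>x. cgrad \<eta> x $ i * \<phi> x)"
    using integration_by_parts_compact[OF \<Omega> \<eta> smooth_Ck, of \<phi> K i] by (simp add: cgrad_def)
qed

lemma has_weak_div_wdiv: "w \<in> Hdiv S \<Longrightarrow> has_weak_div S w (wdiv S w)"
  using someI_ex[of "has_weak_div S w"] by (simp add: wdiv_def Hdiv_def)

lemma wdiv_L2: "w \<in> Hdiv S \<Longrightarrow> wdiv S w \<in> L2 (dom2 S)"
  using has_weak_div_wdiv by (auto simp: has_weak_div_def)

lemma has_weak_grad_wgrad: "u \<in> H1 S \<Longrightarrow> has_weak_grad S u (wgrad S u)"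
  using someI_ex[of "has_weak_grad S u"] by (simp add: wgrad_def H1_def)

lemma Green_homogeneous:
  assumes \<Omega>: "open \<Omega>" "bounded \<Omega>" and S: "S = Homogeneous \<Omega>"
    and \<psi>: "\<psi> \<in> L2 \<Omega>" and g: "has_weak_grad S \<psi> g" and w: "w \<in> Hdiv_0 S"
  shows "ip \<Omega> g w = - ip \<Omega> \<psi> (wdiv S w)"
proof -
  have gL: "g \<in> L2 \<Omega>" using g S by (simp add: has_weak_grad_def)
  have wH: "w \<in> Hdiv S" and wL: "w \<in> L2 \<Omega>" using w S by (auto simp: Hdiv_0_def Hdiv_def)
  have dL: "wdiv S w \<in> L2 \<Omega>" using wdiv_L2[OF wH] S by simp
  obtain \<phi> :: "nat \<Rightarrow> real^2 \<Rightarrow> real^2" where t: "\<And>n i. (\<lambda>x. \<phi> n x $ i) \<in> test S"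
    and l1: "(\<lambda>n. integ \<Omega> (\<lambda>x. (norm (\<phi> n x - w x))\<^sup>2)) \<longlonglongrightarrow> 0"
    and l2: "(\<lambda>n. integ \<Omega> (\<lambda>x. (cdiv (\<phi> n) x - wdiv S w x)\<^sup>2)) \<longlonglongrightarrow> 0"
    using w S by (auto simp: Hdiv_0_def)
  have C: "Ck (Suc 0) (\<lambda>x. \<phi> n x $ i)" for n i
    by (rule smooth_Ck) (use t[of n i] S in simp)
  have cL: "(\<lambda>x. \<phi> n x $ i) \<in> L2 \<Omega>" "part i (\<lambda>x. \<phi> n x $ i) \<in> L2 \<Omega>" for n i
    using L2_continuous[OF \<Omega>] Ck_1_continuous[OF C[of n i]] C[of n i] by auto
  have \<phi>L: "\<phi> n \<in> L2 \<Omega>" for n using cL(1) by (rule L2_vec)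
  have div: "cdiv (\<phi> n) = (\<lambda>x. \<Sum>i\<in>UNIV. part i (\<lambda>x. \<phi> n x $ i) x)" for n
    by (rule ext) (simp add: cdiv_def)
  have divL: "cdiv (\<phi> n) \<in> L2 \<Omega>" for n
    unfolding div by (simp add: UNIV_2 L2_add cL)
  \<comment> \<open>For a test field this is the definition of the weak gradient of
    \<open>\<psi>\<close>, applied to each component.\<close>
  have "ip \<Omega> (\<phi> n) g = - ip \<Omega> (cdiv (\<phi> n)) \<psi>" for n
  proof -
    have "ip \<Omega> (\<phi> n) g = (\<Sum>i\<in>UNIV. ip \<Omega> (\<lambda>x. \<phi> n x $ i) (\<lambda>x. g x $ i))"
      using \<phi>L gL by (rule ip_vec)
    also have "\<dots> = (\<Sum>i\<in>UNIV. - ip \<Omega> (part i (\<lambda>x. \<phi> n x $ i)) \<psi>)"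
    proof (rule sum.cong[OF refl])
      fix i
      have "integ \<Omega> (\<lambda>x. \<psi> x * part i (\<lambda>x. \<phi> n x $ i) x) = - integ \<Omega> (\<lambda>x. g x $ i * \<phi> n x $ i)"
        using g t[of n i] S by (simp add: has_weak_grad_def)
      then show "ip \<Omega> (\<lambda>x. \<phi> n x $ i) (\<lambda>x. g x $ i) = - ip \<Omega> (part i (\<lambda>x. \<phi> n x $ i)) \<psi>"
        by (simp add: ip_def mult.commute)
    qed
    also have "\<dots> = - ip \<Omega> (cdiv (\<phi> n)) \<psi>"
      unfolding div using cL(2) \<psi> by (simp add: ip_sum_left sum_negf)
    finally show ?thesis .
  qed
  moreover have "(\<lambda>n. ip \<Omega> (\<phi> n) g) \<longlonglongrightarrow> ip \<Omega> w g"
    by (rule ip_tendsto[OF \<phi>L wL gL l1])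
  moreover have "(\<lambda>n. ip \<Omega> (cdiv (\<phi> n)) \<psi>) \<longlonglongrightarrow> ip \<Omega> (wdiv S w) \<psi>"
    by (rule ip_tendsto[OF divL dL \<psi>]) (use l2 in simp)
  then have "(\<lambda>n. - ip \<Omega> (cdiv (\<phi> n)) \<psi>) \<longlonglongrightarrow> - ip \<Omega> (wdiv S w) \<psi>" by (rule tendsto_minus)
  ultimately have "ip \<Omega> w g = - ip \<Omega> (wdiv S w) \<psi>" using LIMSEQ_unique by simp
  then show ?thesis by (simp add: ip_commute)
qed

lemma real_polynomial_function_Ck_1: "real_polynomial_function p \<Longrightarrow> Ck (Suc 0) p"
  for p :: "real^2 \<Rightarrow> real"
proof (induction rule: real_polynomial_function.induct)
  case (linear f)
  then show ?case
    by (auto simp: part_linear bounded_linear_imp_differentiable_on)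
next
  case (const c)
  then show ?case by (simp add: part_const)
next
  case (add f g)
  then show ?case by (intro Ck_1_add)
next
  case (mult f g)
  then show ?case by (intro Ck_1_mult)
qed

text \<open>The approximants are polynomials, from Stone-Weierstrass on the compact closure of the
  domain.\<close>

lemma approximable_C1:
  assumes \<Omega>: "open \<Omega>" "bounded \<Omega>" and f: "f \<in> L2 \<Omega>"
  shows "approximable \<Omega> {\<eta>. Ck (Suc 0) \<eta>} f"
proof (rule approximable_uniform[OF \<Omega> f])
  fix h :: "real^2 \<Rightarrow> real" and e :: real assume h: "h \<in> compactly_supported \<Omega>" and "e > 0"
  have "continuous_on (closure \<Omega>) h"
    using h by (auto simp: compactly_supported_def intro: continuous_on_subset)
  then obtain p where p: "real_polynomial_function p" "\<And>x. x \<in> closure \<Omega> \<Longrightarrow> \<bar>h x - p x\<bar> < e"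
    using Stone_Weierstrass_real_polynomial_function[of "closure \<Omega>" h e] \<Omega>(2) \<open>e > 0\<close> by auto
  then have "Ck (Suc 0) p" using real_polynomial_function_Ck_1 by blast
  then show "\<exists>p\<in>{\<eta>. Ck (Suc 0) \<eta>}. continuous_on UNIV p \<and> (\<forall>x\<in>\<Omega>. \<bar>h x - p x\<bar> < e)"
    using p(2) closure_subset Ck_1_continuous by (intro bexI[of _ p]) auto
qed

section \<open>Green's formula for conforming fields: periodic boundary conditions\<close>

definition periodic :: "real^2 \<Rightarrow> real^2 \<Rightarrow> (real^2 \<Rightarrow> real) \<Rightarrow> bool" where
  "periodic a b \<phi> \<longleftrightarrow> (\<forall>x i. \<phi> (x + axis i (b $ i - a $ i)) = \<phi> x)"

text \<open>Trigonometric polynomials are described abstractly as the members of finite-dimensional spaces of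
  periodic functions that are closed under differentiation. This makes closure under products and the
  commutation of projections with derivatives immediate.\<close>

definition trig_basis :: "real^2 \<Rightarrow> real^2 \<Rightarrow> (real^2 \<Rightarrow> real) set \<Rightarrow> bool" where
  "trig_basis a b B \<longleftrightarrow> finite B \<and>
     (\<forall>\<phi>\<in>B. \<phi> differentiable_on UNIV \<and> periodic a b \<phi> \<and> (\<forall>i. part i \<phi> \<in> lin B))"

definition trig :: "real^2 \<Rightarrow> real^2 \<Rightarrow> (real^2 \<Rightarrow> real) set" where
  "trig a b = {\<phi>. \<exists>B. trig_basis a b B \<and> \<phi> \<in> lin B}"

lemma trig_basis_lin:
  assumes "trig_basis a b B" "\<phi> \<in> lin B"
  shows "\<phi> differentiable_on UNIV \<and> periodic a b \<phi> \<and> (\<forall>i. part i \<phi> \<in> lin B)"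
  using assms(2)
proof induction
  case zero
  then show ?case by (simp add: periodic_def part_const lin.zero)
next
  case (step \<beta> f c)
  then have \<beta>: "\<beta> differentiable_on UNIV" "periodic a b \<beta>" "\<And>i. part i \<beta> \<in> lin B"
    using assms(1) by (auto simp: trig_basis_def)
  have c\<beta>: "(\<lambda>x. c * \<beta> x) differentiable_on UNIV" using \<beta>(1) by (intro differentiable_on_mult) auto
  have "part i (\<lambda>x. f x + c * \<beta> x) \<in> lin B" for i
  proof -
    have "part i (\<lambda>x. f x + c * \<beta> x) = (\<lambda>x. part i f x + c *\<^sub>R part i \<beta> x)"
      using part_add[of f "\<lambda>x. c * \<beta> x" i] part_cmult[OF \<beta>(1), of i c] c\<beta> step.IH by simp
    then show ?thesis using lin_add[OF _ lin_scale[OF \<beta>(3)]] step.IH by simp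
  qed
  then show ?case using step.IH \<beta>(2) c\<beta> by (simp add: periodic_def differentiable_on_add)
qed

text \<open>A derivative stays in the same span, so one order of differentiability yields all
  orders.\<close>

lemma trig_basis_Ck:
  assumes "trig_basis a b B" "\<phi> \<in> lin B"
  shows "Ck k \<phi>"
  using assms(2)
proof (induction k arbitrary: \<phi>)
  case 0
  then show ?case using trig_basis_lin[OF assms(1)] by (simp add: differentiable_imp_continuous_on)
next
  case (Suc k)
  then show ?case using trig_basis_lin[OF assms(1)] by simp
qed

lemma trig_basis_test:
  assumes "trig_basis a b B" "\<phi> \<in> lin B"
  shows "\<phi> \<in> test (Periodic a b)"
  using trig_basis_Ck[OF assms] trig_basis_lin[OF assms] by (simp add: smooth_def periodic_def)

lemma trig_basis_Un:
  assumes "trig_basis a b B" "trig_basis a b C"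
  shows "trig_basis a b (B \<union> C)"
  using assms lin_mono[of B "B \<union> C"] lin_mono[of C "B \<union> C"] unfolding trig_basis_def by blast

lemma lin_mult:
  assumes "f \<in> lin B" "g \<in> lin C"
  shows "(\<lambda>x. f x * g x :: real) \<in> lin ((\<lambda>(\<beta>, \<gamma>) x. \<beta> x * \<gamma> x) ` (B \<times> C))" (is "_ \<in> lin ?P")
  using assms(1)
proof induction
  case zero
  then show ?case by (simp add: lin.zero)
next
  case (step \<beta> f c)
  note \<beta> = step.hyps(1)
  have \<beta>g: "(\<lambda>x. \<beta> x * g x) \<in> lin ?P"
    using assms(2)
  proof induction
    case zero
    then show ?case by (simp add: lin.zero)
  next
    case (step \<gamma> g d)
    have "(\<lambda>x. \<beta> x * \<gamma> x) \<in> ?P" using \<beta> step.hyps(1) by force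
    from lin.step[OF this step.IH, of d] show ?case by (simp add: algebra_simps)
  qed
  from lin_add[OF step.IH lin_scale[OF \<beta>g, of c]] show ?case by (simp add: algebra_simps)
qed

lemma trig_basis_mult:
  assumes "trig_basis a b B" "trig_basis a b C"
  shows "trig_basis a b ((\<lambda>(\<beta>, \<gamma>) x. \<beta> x * \<gamma> x) ` (B \<times> C))" (is "trig_basis a b ?P")
  unfolding trig_basis_def
proof (intro conjI ballI)
  show "finite ?P" using assms by (simp add: trig_basis_def)
  fix \<phi> assume "\<phi> \<in> ?P"
  then obtain \<beta> \<gamma> where \<phi>: "\<beta> \<in> B" "\<gamma> \<in> C" "\<phi> = (\<lambda>x. \<beta> x * \<gamma> x)" by auto
  have \<beta>: "\<beta> differentiable_on UNIV" "periodic a b \<beta>" "\<And>i. part i \<beta> \<in> lin B" "\<beta> \<in> lin B"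
    and \<gamma>: "\<gamma> differentiable_on UNIV" "periodic a b \<gamma>" "\<And>i. part i \<gamma> \<in> lin C" "\<gamma> \<in> lin C"
    using assms \<phi> by (auto simp: trig_basis_def intro: lin_base)
  show "\<phi> differentiable_on UNIV" unfolding \<phi>(3) using \<beta> \<gamma> by (intro differentiable_on_mult)
  show "periodic a b \<phi>" unfolding \<phi>(3) using \<beta> \<gamma> by (simp add: periodic_def)
  show "\<forall>i. part i \<phi> \<in> lin ?P"
    unfolding \<phi>(3) part_mult[OF \<beta>(1) \<gamma>(1)] using \<beta> \<gamma> by (intro allI lin_add lin_mult)
qed

lemma trig_add: "\<phi> \<in> trig a b \<Longrightarrow> \<eta> \<in> trig a b \<Longrightarrow> (\<lambda>x. \<phi> x + \<eta> x) \<in> trig a b"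
proof -
  assume "\<phi> \<in> trig a b" "\<eta> \<in> trig a b"
  then obtain B C where B: "trig_basis a b B" "\<phi> \<in> lin B" and C: "trig_basis a b C" "\<eta> \<in> lin C"
    by (auto simp: trig_def)
  then have "(\<lambda>x. \<phi> x + \<eta> x) \<in> lin (B \<union> C)"
    using lin_mono[of B "B \<union> C"] lin_mono[of C "B \<union> C"] by (intro lin_add) auto
  with trig_basis_Un[OF B(1) C(1)] show ?thesis by (auto simp: trig_def)
qed

lemma trig_mult: "\<phi> \<in> trig a b \<Longrightarrow> \<eta> \<in> trig a b \<Longrightarrow> (\<lambda>x. \<phi> x * \<eta> x) \<in> trig a b"
  unfolding trig_def using trig_basis_mult lin_mult by fastforce

lemma trig_const: "(\<lambda>x. c) \<in> trig a b"
proof -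
  have "trig_basis a b {\<lambda>x. 1}"
    by (simp add: trig_basis_def periodic_def part_const lin.zero)
  moreover have "(\<lambda>x. c) \<in> lin {\<lambda>x. 1 :: real}"
    using lin_scale[OF lin_base[of "\<lambda>x. 1" "{\<lambda>x. 1 :: real}"], of c] by simp
  ultimately show ?thesis by (auto simp: trig_def)
qed

lemma trig_sum: "(\<And>i. i \<in> I \<Longrightarrow> f i \<in> trig a b) \<Longrightarrow> (\<lambda>x. \<Sum>i\<in>I. f i x) \<in> trig a b"
  by (induction I rule: infinite_finite_induct) (auto intro: trig_const trig_add)

section \<open>The torus in four-dimensional space and Stone-Weierstrass on it\<close>

definition angle :: "real^2 \<Rightarrow> real^2 \<Rightarrow> 2 \<Rightarrow> real^2 \<Rightarrow> real" where
  "angle a b i x = 2 * pi / (b $ i - a $ i) * (x $ i - a $ i)"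

text \<open>Differentiation exchanges cosine and sine up to constants, so neither spans a stable
  space alone and the two share one basis.\<close>

lemma trig_cos_sin:
  assumes ab: "\<And>i. a $ i < b $ i"
  shows "(\<lambda>x. cos (angle a b i x)) \<in> trig a b" "(\<lambda>x. sin (angle a b i x)) \<in> trig a b"
proof -
  define \<kappa> where "\<kappa> = 2 * pi / (b $ i - a $ i)"
  define C where "C = (\<lambda>x. cos (angle a b i x))"
  define N where "N = (\<lambda>x. sin (angle a b i x))"
  have ang: "angle a b i = (\<lambda>x. \<kappa> * (x $ i - a $ i))" by (auto simp: angle_def \<kappa>_def)
  have dang: "(angle a b i has_derivative (\<lambda>h. \<kappa> * h $ i)) (at x)" for x
    unfolding ang by (auto intro!: derivative_eq_intros bounded_linear.has_derivative[OF bounded_linear_vec_nth])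
  have dC: "(C has_derivative (\<lambda>h. - sin (angle a b i x) * (\<kappa> * h $ i))) (at x)" for x
    unfolding C_def using has_derivative_cos[OF dang] by (simp add: mult_ac)
  have dN: "(N has_derivative (\<lambda>h. cos (angle a b i x) * (\<kappa> * h $ i))) (at x)" for x
    unfolding N_def using has_derivative_sin[OF dang] by (simp add: mult_ac)
  have pC: "part j C = (\<lambda>x. (- \<kappa> * axis j 1 $ i) *\<^sub>R N x)" for j
    using part_eqI[OF dC] by (auto simp: N_def)
  have pN: "part j N = (\<lambda>x. (\<kappa> * axis j 1 $ i) *\<^sub>R C x)" for j
    using part_eqI[OF dN] by (auto simp: C_def)
  have shift: "angle a b i (x + axis j (b $ j - a $ j)) = angle a b i x + (if j = i then 2 * pi else 0)" for x j
    using ab[of i] by (auto simp: angle_def axis_def field_simps)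
  have "periodic a b C" "periodic a b N" by (auto simp: periodic_def C_def N_def shift)
  moreover have "C differentiable_on UNIV" "N differentiable_on UNIV"
    using dC dN by (auto simp: differentiable_on_def differentiable_def)
  moreover have "part j C \<in> lin {C, N}" "part j N \<in> lin {C, N}" for j
    unfolding pC pN by (rule lin_scale, rule lin_base, simp)+
  ultimately have "trig_basis a b {C, N}" by (simp add: trig_basis_def)
  moreover have "C \<in> lin {C, N}" "N \<in> lin {C, N}" by (auto intro: lin_base)
  ultimately show "(\<lambda>x. cos (angle a b i x)) \<in> trig a b" "(\<lambda>x. sin (angle a b i x)) \<in> trig a b"
    unfolding trig_def C_def[symmetric] N_def[symmetric] by blast+
qed

text \<open>The quotient map of the cell onto a product of two circles, with the cosines grouped
  before the sines. Its coordinates generate the trigonometric polynomials.\<close>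

definition torus :: "real^2 \<Rightarrow> real^2 \<Rightarrow> real^2 \<Rightarrow> (real^2) \<times> (real^2)" where
  "torus a b x = (\<chi> i. cos (angle a b i x), \<chi> i. sin (angle a b i x))"

text \<open>Equal angles mean coordinates differing by a multiple of the period. Within the closed
  cell a nonzero multiple forces both coordinates to be endpoints, so only boundary points are glued
  together.\<close>

lemma torus_eqD:
  assumes ab: "\<And>i. a $ i < b $ i" and x: "x \<in> cbox a b" and y: "y \<in> cbox a b"
    and eq: "torus a b x = torus a b y"
  shows "x = y \<or> x \<notin> box a b \<and> y \<notin> box a b"
proof (cases "x = y")
  case False
  then obtain i where i: "x $ i \<noteq> y $ i" by (auto simp: vec_eq_iff)
  have "cos (angle a b i x) = cos (angle a b i y)" "sin (angle a b i x) = sin (angle a b i y)"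
    using eq by (auto simp: torus_def vec_eq_iff)
  then obtain n :: int where n: "angle a b i x = angle a b i y + 2 * pi * n"
    using sin_cos_eq_iff[of "angle a b i x" "angle a b i y"] by auto
  define L where "L = b $ i - a $ i"
  have L: "L > 0" using ab[of i] by (simp add: L_def)
  have "2 * pi * ((x $ i - a $ i) / L) = 2 * pi * ((y $ i - a $ i) / L + n)"
    using n by (simp add: angle_def L_def distrib_left)
  then have "(x $ i - a $ i) / L = (y $ i - a $ i) / L + n"
    by (rule mult_left_cancel[THEN iffD1, rotated]) simp
  then have xy: "x $ i = y $ i + n * L" using L by (simp add: field_simps)
  have xb: "a $ i \<le> x $ i" "x $ i \<le> a $ i + L" "a $ i \<le> y $ i" "y $ i \<le> a $ i + L"
    using x y by (auto simp: mem_box_cart L_def)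
  have "n \<noteq> 0" using i xy by auto
  then consider "n \<ge> 1" | "n \<le> - 1" by linarith
  then have "x $ i \<notin> {a $ i <..< b $ i} \<and> y $ i \<notin> {a $ i <..< b $ i}"
  proof cases
    case 1
    then have "n * L \<ge> 1 * L" using L by (intro mult_right_mono) auto
    then show ?thesis using xy xb by (auto simp: L_def)
  next
    case 2
    then have "n * L \<le> - 1 * L" using L by (intro mult_right_mono) auto
    then show ?thesis using xy xb by (auto simp: L_def)
  qed
  then show ?thesis by (auto simp: mem_box_cart)
qed simp

lemma continuous_torus: "continuous_on S (torus a b)"
  unfolding torus_def angle_def by (intro continuous_intros continuous_on_vec_lambda)

text \<open>A linear form is a combination of coordinates, and the coordinates of
  \<open>torus\<close> are cosines and sines; closure under sums and products does the rest.\<close>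

lemma trig_polynomial_torus:
  assumes ab: "\<And>i. a $ i < b $ i" and "real_polynomial_function P"
  shows "(\<lambda>x. P (torus a b x)) \<in> trig a b"
  using assms(2)
proof (induction rule: real_polynomial_function.induct)
  case (linear f)
  interpret bounded_linear f by (rule linear)
  have "f y = (\<Sum>\<beta>\<in>Basis. (y \<bullet> \<beta>) * f \<beta>)" for y
    by (subst (1) euclidean_representation[of y, symmetric]) (simp add: sum scaleR)
  then have "(\<lambda>x. f (torus a b x)) = (\<lambda>x. \<Sum>\<beta>\<in>Basis. (torus a b x \<bullet> \<beta>) * f \<beta>)" by (rule ext)
  moreover have "(\<lambda>x. \<Sum>\<beta>\<in>Basis. (torus a b x \<bullet> \<beta>) * f \<beta>) \<in> trig a b"
  proof (intro trig_sum trig_mult trig_const)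
    fix \<beta> :: "(real^2) \<times> (real^2)" assume "\<beta> \<in> Basis"
    then consider i where "\<beta> = (axis i 1, 0)" | i where "\<beta> = (0, axis i 1)"
      by (auto simp: Basis_prod_def Basis_vec_def)
    then show "(\<lambda>x. torus a b x \<bullet> \<beta>) \<in> trig a b"
      by cases (simp_all add: torus_def inner_axis trig_cos_sin[OF ab])
  qed
  ultimately show ?case by simp
qed (auto intro: trig_const trig_add trig_mult)

lemma trig_continuous: "\<phi> \<in> trig a b \<Longrightarrow> continuous_on UNIV \<phi>"
  unfolding trig_def using trig_basis_Ck[of a b _ \<phi> 0] by auto

text \<open>A function with compact support in the fundamental cell factors through the torus, where the
  Stone--Weierstrass theorem applies.\<close>

lemma trig_uniformly_dense:
  assumes ab: "\<And>i. a $ i < b $ i" and h: "h \<in> compactly_supported (box a b)" and "e > 0"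
  shows "\<exists>p\<in>trig a b. continuous_on UNIV p \<and> (\<forall>x\<in>box a b. \<bar>h x - p x\<bar> < e)"
proof -
  define T where "T = torus a b ` cbox a b"
  \<comment> \<open>The choice of preimage is immaterial: distinct preimages lie on the boundary of
    the cell, where \<open>h\<close> is 0.\<close>
  define F where "F = (\<lambda>y. h (inv_into (cbox a b) (torus a b) y))"
  have hc: "continuous_on UNIV h" and h0: "\<And>x. x \<notin> box a b \<Longrightarrow> h x = 0"
    using h by (auto simp: compactly_supported_def)
  have F: "F (torus a b x) = h x" if x: "x \<in> cbox a b" for x
  proof -
    define y where "y = inv_into (cbox a b) (torus a b) (torus a b x)"
    have y: "y \<in> cbox a b" "torus a b y = torus a b x"
      unfolding y_def using x by (auto intro: inv_into_into f_inv_into_f)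
    have "h y = h x" using torus_eqD[OF ab y(1) x y(2)] h0 by auto
    then show ?thesis by (simp add: F_def y_def)
  qed
  have T: "compact T" unfolding T_def by (intro compact_continuous_image continuous_torus compact_cbox)
  \<comment> \<open>The torus map sends compact subsets of the cell to compact sets, so preimages of
    closed sets under \<open>F\<close> are closed: \<open>F\<close> inherits continuity from
    \<open>h\<close> through a quotient map.\<close>
  have "continuous_on T F"
  proof (subst continuous_on_closed_gen[of F T UNIV]; (intro allI impI)?)
    fix U :: "real set" assume "closedin (top_of_set UNIV) U"
    then have U: "closed U" by simp
    have "T \<inter> F -` U = torus a b ` (cbox a b \<inter> h -` U)" using F by (auto simp: T_def)
    moreover have "compact (torus a b ` (cbox a b \<inter> h -` U))"
      using U hc by (intro compact_continuous_image continuous_torus compact_Int_closed closed_vimage) auto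
    ultimately have "closed (T \<inter> F -` U)" by (simp add: compact_imp_closed)
    then show "closedin (top_of_set T) (T \<inter> F -` U)" by (simp add: closed_subset)
  qed auto
  then obtain P where P: "real_polynomial_function P" "\<And>y. y \<in> T \<Longrightarrow> \<bar>F y - P y\<bar> < e"
    using Stone_Weierstrass_real_polynomial_function[OF T _ \<open>e > 0\<close>, of F] by blast
  have t: "(\<lambda>x. P (torus a b x)) \<in> trig a b" using ab P(1) by (rule trig_polynomial_torus)
  moreover have "\<bar>h x - P (torus a b x)\<bar> < e" if "x \<in> box a b" for x
    using P(2)[of "torus a b x"] F[of x] that box_subset_cbox by (force simp: T_def)
  ultimately show ?thesis using trig_continuous[OF t] by blast
qed

lemma approximable_trig:
  assumes ab: "\<And>i. a $ i < b $ i" and f: "f \<in> L2 (box a b)"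
  shows "approximable (box a b) (trig a b) f"
  using open_box bounded_box f trig_uniformly_dense[OF ab] by (rule approximable_uniform)

lemma trig_basis_L2:
  assumes "trig_basis a b B"
  shows "B \<subseteq> L2 (box a b)"
proof
  fix \<phi> assume "\<phi> \<in> B"
  then have "continuous_on UNIV \<phi>" using trig_basis_Ck[OF assms lin_base, of \<phi> 0] by simp
  then show "\<phi> \<in> L2 (box a b)" by (rule L2_continuous[OF open_box bounded_box])
qed

lemma trig_basis_integration_by_parts:
  assumes ab: "\<And>i. a $ i < b $ i" and B: "trig_basis a b B" and \<phi>: "\<phi> \<in> lin B" and \<eta>: "\<eta> \<in> lin B"
  shows "ip (box a b) (part i \<phi>) \<eta> = - ip (box a b) \<phi> (part i \<eta>)"
  using integration_by_parts_periodic[OF ab trig_basis_Ck[OF B \<phi>] trig_basis_Ck[OF B \<eta>], of i]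
    trig_basis_lin[OF B] \<phi> \<eta>
  by (simp add: ip_def periodic_def)

text \<open>The orthogonal projection onto a space of trigonometric polynomials closed under differentiation maps
  \<open>\<psi>\<close> to a function whose gradient is, up to null sets, the projection of the weak gradient.\<close>

lemma Green_periodic:
  assumes ab: "\<And>i. a $ i < b $ i" and \<Omega>: "\<Omega> = box a b" and S: "S = Periodic a b"
    and \<psi>: "\<psi> \<in> L2 \<Omega>" and g: "has_weak_grad S \<psi> g" and w: "w \<in> Hdiv S"
  shows "ip \<Omega> g w = - ip \<Omega> \<psi> (wdiv S w)"
proof -
  define d where "d = wdiv S w"
  have gL: "g \<in> L2 \<Omega>" using g S \<Omega> by (simp add: has_weak_grad_def)
  have wL: "w \<in> L2 \<Omega>" using w S \<Omega> by (simp add: Hdiv_def)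
  have dL: "d \<in> L2 \<Omega>" using wdiv_L2[OF w] S \<Omega> by (simp add: d_def)
  note comp = L2_component[OF gL] L2_component[OF wL]
  \<comment> \<open>Cauchy-Schwarz against \<open>d\<close> and against each component of
    \<open>w\<close> produces these factors, one for each projection error.\<close>
  define M where "M = sqrt (ip \<Omega> d d) + (\<Sum>i\<in>UNIV. sqrt (ip \<Omega> (\<lambda>x. w x $ i) (\<lambda>x. w x $ i)))"
  have bound: "\<bar>ip \<Omega> g w + ip \<Omega> \<psi> d\<bar> \<le> \<delta> * M" if "\<delta> > 0" for \<delta>
  proof -
    have \<delta>2: "\<delta>\<^sup>2 > 0" using that by simp
    obtain p where p: "p \<in> trig a b" "ip \<Omega> (\<lambda>x. \<psi> x - p x) (\<lambda>x. \<psi> x - p x) < \<delta>\<^sup>2"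
      using approximable_trig[OF ab, of \<psi>] \<psi> \<delta>2 unfolding \<Omega> approximable_def by blast
    have "\<exists>q. q \<in> trig a b \<and> ip \<Omega> (\<lambda>x. g x $ i - q x) (\<lambda>x. g x $ i - q x) < \<delta>\<^sup>2" for i
      using approximable_trig[OF ab, of "\<lambda>x. g x $ i"] comp(1)[of i] \<delta>2 unfolding \<Omega> approximable_def by blast
    then have "\<exists>q. \<forall>i. q i \<in> trig a b \<and> ip \<Omega> (\<lambda>x. g x $ i - q i x) (\<lambda>x. g x $ i - q i x) < \<delta>\<^sup>2"
      by (intro choice) auto
    then obtain q where q: "\<And>i. q i \<in> trig a b" "\<And>i. ip \<Omega> (\<lambda>x. g x $ i - q i x) (\<lambda>x. g x $ i - q i x) < \<delta>\<^sup>2"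
      by blast
    obtain B0 B1 B2 where B012: "trig_basis a b B0" "p \<in> lin B0" "trig_basis a b B1" "q 1 \<in> lin B1"
        "trig_basis a b B2" "q 2 \<in> lin B2"
      using p(1) q(1)[of 1] q(1)[of 2] unfolding trig_def by blast
    \<comment> \<open>One space containing all three approximants, so that \<open>\<psi>\<close> and
      both components of \<open>g\<close> are projected onto the same span.\<close>
    define B where "B = B0 \<union> (B1 \<union> B2)"
    have B: "trig_basis a b B" unfolding B_def using B012 by (intro trig_basis_Un)
    have pB: "p \<in> lin B" and qB: "q i \<in> lin B" for i
      using B012 lin_mono[of B0 B] lin_mono[of B1 B] lin_mono[of B2 B] exhaust_2[of i] by (auto simp: B_def)
    have fin: "finite B" and BL: "B \<subseteq> L2 \<Omega>" using B trig_basis_L2[OF B] by (auto simp: trig_basis_def \<Omega>)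
    have L: "v \<in> L2 \<Omega>" if "v \<in> lin B" for v using lin_L2[OF BL] that by blast
    obtain \<eta> where \<eta>: "\<eta> \<in> lin B" "\<And>v. v \<in> lin B \<Longrightarrow> ip \<Omega> \<eta> v = ip \<Omega> \<psi> v"
      using projection_lin[OF fin BL \<psi>] by blast
    have "\<exists>\<gamma>. \<gamma> \<in> lin B \<and> (\<forall>v\<in>lin B. ip \<Omega> \<gamma> v = ip \<Omega> (\<lambda>x. g x $ i) v)" for i
      using projection_lin[OF fin BL comp(1)[of i]] by (simp only: Bex_def)
    then have "\<exists>\<gamma>. \<forall>i. \<gamma> i \<in> lin B \<and> (\<forall>v\<in>lin B. ip \<Omega> (\<gamma> i) v = ip \<Omega> (\<lambda>x. g x $ i) v)"
      by (intro choice) auto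
    then obtain \<gamma> where \<gamma>: "\<And>i. \<gamma> i \<in> lin B" "\<And>i v. v \<in> lin B \<Longrightarrow> ip \<Omega> (\<gamma> i) v = ip \<Omega> (\<lambda>x. g x $ i) v"
      by blast
    have p\<eta>: "part i \<eta> \<in> lin B" for i using trig_basis_lin[OF B \<eta>(1)] by blast
    have "ip \<Omega> (part i \<eta>) (\<lambda>x. w x $ i) = ip \<Omega> (\<gamma> i) (\<lambda>x. w x $ i)" for i
    proof -
      \<comment> \<open>\<open>r\<close> lies in the span, hence is a test function against which
        both projections can be evaluated. The chain below shows that it is orthogonal to itself,
        hence null.\<close>
      define r where "r = (\<lambda>x. part i \<eta> x - \<gamma> i x)"
      have r: "r \<in> lin B" unfolding r_def using p\<eta> \<gamma>(1) by (rule lin_diff)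
      have "ip \<Omega> (part i \<eta>) r = - ip \<Omega> \<eta> (part i r)"
        unfolding \<Omega> using ab B \<eta>(1) r by (rule trig_basis_integration_by_parts)
      also have "\<dots> = - ip \<Omega> \<psi> (part i r)" using \<eta>(2) trig_basis_lin[OF B r] by simp
      also have "\<dots> = ip \<Omega> (\<lambda>x. g x $ i) r"
        using g trig_basis_test[OF B r] unfolding has_weak_grad_def S \<Omega> by (simp add: ip_def del: test.simps)
      also have "\<dots> = ip \<Omega> (\<gamma> i) r" using \<gamma>(2)[OF r] by simp
      finally have "ip \<Omega> (\<lambda>x. part i \<eta> x - \<gamma> i x) r = 0"
        by (simp add: ip_diff_left[OF L[OF p\<eta>] L[OF \<gamma>(1)] L[OF r]])
      then have "ip \<Omega> r r = 0" by (simp only: r_def[symmetric])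
      then have "ip \<Omega> r (\<lambda>x. w x $ i) = 0" using ip_eq_0_if_null[OF L[OF r] comp(2)] by simp
      then show ?thesis unfolding r_def using L p\<eta> \<gamma>(1) comp(2) by (simp add: ip_diff_left)
    qed
    moreover have "(\<Sum>i\<in>UNIV. ip \<Omega> (part i \<eta>) (\<lambda>x. w x $ i)) = - ip \<Omega> \<eta> d"
    proof -
      have cg: "cgrad \<eta> \<in> L2 \<Omega>"
        unfolding \<Omega> using trig_basis_Ck[OF B \<eta>(1)] by (intro cgrad_L2) auto
      have "(\<Sum>i\<in>UNIV. ip \<Omega> (part i \<eta>) (\<lambda>x. w x $ i)) = ip \<Omega> (cgrad \<eta>) w"
        unfolding ip_vec[OF cg wL] by (simp add: cgrad_def)
      also have "\<dots> = - ip \<Omega> \<eta> d"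
        using has_weak_div_wdiv[OF w] trig_basis_test[OF B \<eta>(1)] unfolding has_weak_div_def S \<Omega> d_def
        by (simp add: ip_def inner_commute mult.commute del: test.simps)
      finally show ?thesis .
    qed
    \<comment> \<open>Green's formula holds exactly for the projections, so only their errors
      remain.\<close>
    ultimately have "(\<Sum>i\<in>UNIV. ip \<Omega> (\<gamma> i) (\<lambda>x. w x $ i)) + ip \<Omega> \<eta> d = 0" by simp
    then have "ip \<Omega> g w + ip \<Omega> \<psi> d
        = (\<Sum>i\<in>UNIV. ip \<Omega> (\<lambda>x. g x $ i - \<gamma> i x) (\<lambda>x. w x $ i)) + ip \<Omega> (\<lambda>x. \<psi> x - \<eta> x) d"
      using L[OF \<gamma>(1)] L[OF \<eta>(1)] comp \<psi> dL by (simp add: ip_vec[OF gL wL] ip_diff_left sum_subtractf)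
    \<comment> \<open>The error of the projection \<open>k\<close> is bounded through that of some
      \<open>l\<close> in the span whose distance to \<open>f\<close> is known.\<close>
    moreover have cs: "\<bar>ip \<Omega> (\<lambda>x. f x - k x) v\<bar> \<le> \<delta> * sqrt (ip \<Omega> v v)"
      if "f \<in> L2 \<Omega>" "v \<in> L2 \<Omega>" "k \<in> lin B" "\<And>v. v \<in> lin B \<Longrightarrow> ip \<Omega> k v = ip \<Omega> f v"
        "l \<in> lin B" "ip \<Omega> (\<lambda>x. f x - l x) (\<lambda>x. f x - l x) < \<delta>\<^sup>2" for f k v l
    proof -
      have "(ip \<Omega> (\<lambda>x. f x - k x) v)\<^sup>2 \<le> ip \<Omega> (\<lambda>x. f x - k x) (\<lambda>x. f x - k x) * ip \<Omega> v v"
        using that L by (intro ip_Cauchy_Schwarz L2_diff) auto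
      also have "\<dots> \<le> \<delta>\<^sup>2 * ip \<Omega> v v"
        using best_approximation[OF BL that(1,3,4,5)] that(6) ip_self_nonneg[of \<Omega> v]
        by (intro mult_right_mono) auto
      finally have "\<bar>ip \<Omega> (\<lambda>x. f x - k x) v\<bar> \<le> sqrt (\<delta>\<^sup>2 * ip \<Omega> v v)"
        by (intro real_le_rsqrt) simp
      then show ?thesis using \<open>\<delta> > 0\<close> by (simp add: real_sqrt_mult)
    qed
    have "\<bar>ip \<Omega> (\<lambda>x. \<psi> x - \<eta> x) d\<bar> \<le> \<delta> * sqrt (ip \<Omega> d d)"
      using \<psi> dL \<eta> pB p(2) by (rule cs)
    moreover have "\<bar>\<Sum>i\<in>UNIV. ip \<Omega> (\<lambda>x. g x $ i - \<gamma> i x) (\<lambda>x. w x $ i)\<bar>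
        \<le> (\<Sum>i\<in>UNIV. \<delta> * sqrt (ip \<Omega> (\<lambda>x. w x $ i) (\<lambda>x. w x $ i)))"
    proof (rule order_trans[OF sum_abs sum_mono])
      show "\<bar>ip \<Omega> (\<lambda>x. g x $ i - \<gamma> i x) (\<lambda>x. w x $ i)\<bar> \<le> \<delta> * sqrt (ip \<Omega> (\<lambda>x. w x $ i) (\<lambda>x. w x $ i))" for i
        using comp(1) comp(2) \<gamma>(1) \<gamma>(2) qB q(2) by (rule cs)
    qed
    ultimately show ?thesis by (simp add: M_def distrib_left sum_distrib_left)
  qed
  have "\<bar>ip \<Omega> g w + ip \<Omega> \<psi> d\<bar> \<le> 0"
  proof (rule field_le_epsilon)
    fix e :: real assume "e > 0"
    have M: "M \<ge> 0" unfolding M_def by (intro add_nonneg_nonneg sum_nonneg real_sqrt_ge_zero ip_self_nonneg)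
    \<comment> \<open>The summand 1 keeps the chosen \<delta> well defined when
      \<open>M = 0\<close>.\<close>
    have "\<bar>ip \<Omega> g w + ip \<Omega> \<psi> d\<bar> \<le> e / (M + 1) * M" using \<open>e > 0\<close> M by (intro bound) simp
    also have "\<dots> \<le> e" using \<open>e > 0\<close> M by (simp add: field_simps)
    finally show "\<bar>ip \<Omega> g w + ip \<Omega> \<psi> d\<bar> \<le> 0 + e" by simp
  qed
  then show ?thesis by (simp add: d_def)
qed

section \<open>Discrete operators\<close>

lemma V1_Hdiv: "w \<in> V1 S \<Longrightarrow> w \<in> Hdiv S"
  by (cases S) (auto simp: Hdiv_0_def)

lemma V1_L2: "w \<in> V1 S \<Longrightarrow> w \<in> L2 (dom2 S)"
  using V1_Hdiv by (auto simp: Hdiv_def)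

lemma Green:
  assumes S: "admissible S" and \<psi>: "\<psi> \<in> L2 (dom2 S)" and g: "has_weak_grad S \<psi> g" and w: "w \<in> V1 S"
  shows "ip (dom2 S) g w = - ip (dom2 S) \<psi> (wdiv S w)"
proof (cases S)
  case (Periodic a b)
  then show ?thesis using S \<psi> g w by (intro Green_periodic[of a b]) auto
next
  case (Homogeneous \<Omega>)
  then show ?thesis using S \<psi> g w by (intro Green_homogeneous[of "dom2 S"]) auto
qed

text \<open>Against such an \<open>\<eta>\<close> the chosen divergence of \<open>w\<close> can be
  replaced by an expression linear in \<open>w\<close>, because \<open>G\<close> does not depend on
  \<open>w\<close>; it is the gradient of \<open>\<eta>\<close>. Density then lets these pairings
  determine \<open>wdiv\<close> up to null sets.\<close>

lemma dense_Green_functions: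
  assumes S: "admissible S" and f: "f \<in> L2 (dom2 S)"
  shows "approximable (dom2 S) {\<eta>. \<exists>G\<in>L2 (dom2 S). \<forall>w\<in>V1 S. ip (dom2 S) (wdiv S w) \<eta> = - ip (dom2 S) w G} f"
    (is "approximable _ ?D f")
proof -
  have mono: "approximable (dom2 S) ?D f" if "approximable (dom2 S) E f" "E \<subseteq> ?D" for E
    using that unfolding approximable_def by blast
  show ?thesis
  proof (cases S)
    case (Periodic a b)
    then have ab: "\<And>i. a $ i < b $ i" and fb: "f \<in> L2 (box a b)" using S f by auto
    have "trig a b \<subseteq> ?D"
    proof
      fix \<eta> assume "\<eta> \<in> trig a b"
      then obtain B where B: "trig_basis a b B" "\<eta> \<in> lin B" by (auto simp: trig_def)
      have "cgrad \<eta> \<in> L2 (dom2 S)"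
        using trig_basis_Ck[OF B] Periodic by (simp only: dom2.simps) (intro cgrad_L2 open_box bounded_box)
      moreover have "ip (dom2 S) (wdiv S w) \<eta> = - ip (dom2 S) w (cgrad \<eta>)" if "w \<in> V1 S" for w
        using has_weak_div_wdiv[OF V1_Hdiv[OF that]] trig_basis_test[OF B] Periodic
        unfolding has_weak_div_def by (simp add: ip_def del: test.simps)
      ultimately show "\<eta> \<in> ?D" by blast
    qed
    moreover have "approximable (dom2 S) (trig a b) f"
      using approximable_trig[OF ab fb] Periodic by simp
    ultimately show ?thesis by (intro mono)
  next
    case (Homogeneous \<Omega>)
    then have \<Omega>: "open \<Omega>" "bounded \<Omega>" and f\<Omega>: "f \<in> L2 \<Omega>" using S f by auto
    have "{\<eta>. Ck (Suc 0) \<eta>} \<subseteq> ?D"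
    proof
      fix \<eta> assume "\<eta> \<in> {\<eta>. Ck (Suc 0) \<eta>}"
      then have \<eta>: "Ck (Suc 0) \<eta>" by blast
      have "cgrad \<eta> \<in> L2 (dom2 S)" using cgrad_L2[OF \<Omega> \<eta>] Homogeneous by simp
      moreover have "ip (dom2 S) (wdiv S w) \<eta> = - ip (dom2 S) w (cgrad \<eta>)" if "w \<in> V1 S" for w
      proof -
        have "\<eta> \<in> L2 (dom2 S)" "has_weak_grad S \<eta> (cgrad \<eta>)"
          using L2_continuous[OF \<Omega> Ck_1_continuous[OF \<eta>]] has_weak_grad_cgrad[OF \<Omega> \<eta>] Homogeneous
          by simp_all
        from Green[OF S this that] show ?thesis
          unfolding ip_commute[of _ "wdiv S w"] ip_commute[of _ w] by simp
      qed
      ultimately show "\<eta> \<in> ?D" by blast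
    qed
    moreover have "approximable (dom2 S) {\<eta>. Ck (Suc 0) \<eta>} f"
      using approximable_C1[OF \<Omega> f\<Omega>] Homogeneous by simp
    ultimately show ?thesis by (intro mono)
  qed
qed

text \<open>The three divergences are independent choices. Their defect is orthogonal to every
  function of the preceding dense class, hence null.\<close>

lemma wdiv_linear:
  assumes S: "admissible S" and v: "v \<in> V1 S" and w: "w \<in> V1 S" and vw: "(\<lambda>x. v x + c *\<^sub>R w x) \<in> V1 S"
  shows "ae_eq (dom2 S) (wdiv S (\<lambda>x. v x + c *\<^sub>R w x)) (\<lambda>x. wdiv S v x + c * wdiv S w x)"
proof -
  let ?\<Omega> = "dom2 S"
  let ?u = "\<lambda>x. v x + c *\<^sub>R w x"
  note L = wdiv_L2[OF V1_Hdiv]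
  define s where "s = (\<lambda>x. wdiv S v x + c *\<^sub>R wdiv S w x)"
  have s: "s \<in> L2 ?\<Omega>" unfolding s_def using L[OF v] L[OF w] by (intro L2_add L2_scale)
  define r where "r = (\<lambda>x. wdiv S ?u x - s x)"
  have r: "r \<in> L2 ?\<Omega>" unfolding r_def using L[OF vw] s by (rule L2_diff)
  have "ip ?\<Omega> r r = 0"
  proof (rule orthogonal_to_dense[OF r dense_Green_functions[OF S r]])
    fix \<eta> assume \<eta>: "\<eta> \<in> L2 ?\<Omega>"
      and "\<eta> \<in> {\<eta>. \<exists>G\<in>L2 ?\<Omega>. \<forall>w\<in>V1 S. ip ?\<Omega> (wdiv S w) \<eta> = - ip ?\<Omega> w G}"
    then obtain G where G: "G \<in> L2 ?\<Omega>" "\<And>w. w \<in> V1 S \<Longrightarrow> ip ?\<Omega> (wdiv S w) \<eta> = - ip ?\<Omega> w G" by blast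
    have "ip ?\<Omega> r \<eta> = ip ?\<Omega> (wdiv S ?u) \<eta> - ip ?\<Omega> s \<eta>"
      unfolding r_def using L[OF vw] s \<eta> by (rule ip_diff_left)
    also have "ip ?\<Omega> s \<eta> = ip ?\<Omega> (wdiv S v) \<eta> + c * ip ?\<Omega> (wdiv S w) \<eta>"
      unfolding s_def ip_add_left[OF L[OF v] L2_scale[OF L[OF w]] \<eta>] ip_scale_left ..
    also have "ip ?\<Omega> ?u G = ip ?\<Omega> v G + c * ip ?\<Omega> w G"
      unfolding ip_add_left[OF V1_L2[OF v] L2_scale[OF V1_L2[OF w]] G(1)] ip_scale_left ..
    then have "ip ?\<Omega> (wdiv S ?u) \<eta> = ip ?\<Omega> (wdiv S v) \<eta> + c * ip ?\<Omega> (wdiv S w) \<eta>"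
      unfolding G(2)[OF vw] G(2)[OF v] G(2)[OF w] by simp
    finally show "ip ?\<Omega> r \<eta> = 0" by simp
  qed
  then have "ae_eq ?\<Omega> r (\<lambda>x. 0)" using ip_self_eq_0_iff[OF r] by simp
  then show ?thesis by (simp add: r_def s_def)
qed

section \<open>Broken spaces: exact uniqueness and projections\<close>

lemma broken_space_lin:
  assumes "broken_space \<Omega> V"
  obtains B where "finite B" "B \<subseteq> L2 \<Omega>" "V = lin B"
proof -
  have V: "finite_dimensional V" "V \<subseteq> L2 \<Omega>" using assms by (auto simp: broken_space_def)
  obtain B where B: "finite B" "V = lin B" using V(1) by (rule finite_dimensional_lin)
  then have "B \<subseteq> L2 \<Omega>" using V(2) lin_base by blast
  with B show thesis by (intro that)
qed

lemma broken_space_add: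
  assumes "broken_space \<Omega> V" "f \<in> V" "g \<in> V"
  shows "(\<lambda>x. f x + c *\<^sub>R g x) \<in> V"
proof -
  obtain B where "finite B" "B \<subseteq> L2 \<Omega>" and B: "V = lin B" using assms(1) by (rule broken_space_lin)
  show ?thesis using assms(2,3) unfolding B by (intro lin_add lin_scale)
qed

lemma broken_space_diff:
  assumes "broken_space \<Omega> V" "f \<in> V" "g \<in> V"
  shows "(\<lambda>x. f x - g x) \<in> V"
  using broken_space_add[OF assms, of "-1"] by simp

text \<open>This turns identities modulo null sets into equalities of functions, and so makes the
  descriptions in \<open>rep\<close>, \<open>L2_proj\<close> and \<open>tgrad_h\<close>
  unique.\<close>

lemma broken_space_ae_eq:
  assumes V: "broken_space \<Omega> V" and f: "f \<in> V" and g: "g \<in> V" and "ae_eq \<Omega> f g"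
  shows "f = g"
proof -
  have "(\<lambda>x. f x - g x) = (\<lambda>x. 0)"
    using broken_space_diff[OF V f g] V assms(4) by (simp add: broken_space_def)
  then show ?thesis by (auto simp: fun_eq_iff)
qed

lemma broken_space_ip_cancel:
  assumes V: "broken_space \<Omega> V" and f: "f \<in> V" and g: "g \<in> V"
    and eq: "\<And>v. v \<in> V \<Longrightarrow> ip \<Omega> f v = ip \<Omega> g v"
  shows "f = g"
proof -
  have L: "v \<in> L2 \<Omega>" if "v \<in> V" for v using V that by (auto simp: broken_space_def)
  define r where "r = (\<lambda>x. f x - g x)"
  have r: "r \<in> V" unfolding r_def using V f g by (rule broken_space_diff)
  have "ip \<Omega> (\<lambda>x. f x - g x) r = 0"
    using ip_diff_left[OF L[OF f] L[OF g] L[OF r]] eq[OF r] by simp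
  then have "ip \<Omega> r r = 0" by (simp only: r_def[symmetric])
  then have "ae_eq \<Omega> r (\<lambda>x. 0)" using ip_self_eq_0_iff[OF L[OF r]] by simp
  then show ?thesis using V f g by (intro broken_space_ae_eq[of \<Omega> V]) (auto simp: r_def)
qed

lemma L2_proj:
  assumes V: "broken_space \<Omega> V" and f: "f \<in> L2 \<Omega>"
  shows "L2_proj \<Omega> V f \<in> V" "\<And>v. v \<in> V \<Longrightarrow> ip \<Omega> (L2_proj \<Omega> V f) v = ip \<Omega> f v"
proof -
  obtain B where B: "finite B" "B \<subseteq> L2 \<Omega>" "V = lin B" using V by (rule broken_space_lin)
  have L: "v \<in> L2 \<Omega>" if "v \<in> V" for v using V that by (auto simp: broken_space_def)
  let ?P = "\<lambda>p. p \<in> V \<and> (\<forall>v\<in>V. integ \<Omega> (\<lambda>x. (f x - p x) \<bullet> v x) = 0)"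
  have P: "?P p \<longleftrightarrow> p \<in> V \<and> (\<forall>v\<in>V. ip \<Omega> p v = ip \<Omega> f v)" for p
    using ip_diff_left[OF f L L, of p] by (auto simp: ip_def)
  have "\<exists>p. ?P p" unfolding P using projection_lin[OF B(1,2) f] B(3) by blast
  moreover have "p = q" if "?P p" "?P q" for p q
    using V that unfolding P by (intro broken_space_ip_cancel[of \<Omega> V]) auto
  ultimately have "\<exists>!p. ?P p" by (rule ex_ex1I)
  then have "?P (L2_proj \<Omega> V f)" unfolding L2_proj_def by (rule theI')
  then show "L2_proj \<Omega> V f \<in> V" "\<And>v. v \<in> V \<Longrightarrow> ip \<Omega> (L2_proj \<Omega> V f) v = ip \<Omega> f v"
    unfolding P by blast+
qed

section \<open>The discrete divergence and its adjoint\<close>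

lemma P1c_linear:
  assumes D: "broken_discretization D" and "v \<in> Vh1 D" "w \<in> Vh1 D"
  shows "P1c D (\<lambda>x. v x + c *\<^sub>R w x) = (\<lambda>x. P1c D v x + c *\<^sub>R P1c D w x)"
proof -
  have "linear_projection (Vh1 D) (Vh1c D) (P1c D)" using D by (simp add: broken_discretization_def)
  then have "P1c D (\<lambda>x. a *\<^sub>R v x + b *\<^sub>R w x) = (\<lambda>x. a *\<^sub>R P1c D v x + b *\<^sub>R P1c D w x)" for a b
    using assms(2,3) by (simp add: linear_projection_def)
  from this[of 1 c] show ?thesis by simp
qed

lemma P1c_V1:
  assumes "broken_discretization D" "v \<in> Vh1 D"
  shows "P1c D v \<in> Vh1c D" "P1c D v \<in> V1 (setting D)"
proof -
  have "P1c D ` Vh1 D = Vh1c D"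
    using assms(1) unfolding broken_discretization_def linear_projection_def by blast
  then show "P1c D v \<in> Vh1c D" using assms(2) by blast
  then show "P1c D v \<in> V1 (setting D)" by (simp add: Vh1c_def)
qed

text \<open>The representative exists because divergences of conforming fields lie in the conforming
  part of \<open>Vh2\<close> modulo null sets; it is unique because \<open>Vh2\<close> is a broken
  space.\<close>

lemma div_h:
  assumes D: "broken_discretization D" and v: "v \<in> Vh1 D"
  shows "div_h D v \<in> Vh2 D" "ae_eq (Om D) (div_h D v) (wdiv (setting D) (P1c D v))"
proof -
  let ?d = "wdiv (setting D) (P1c D v)"
  have V: "broken_space (Om D) (Vh2 D)" using D by (simp add: broken_discretization_def)
  have "\<exists>q\<in>Vh2c D. ae_eq (Om D) q ?d"
    using D P1c_V1(1)[OF D v] unfolding broken_discretization_def by blast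
  then obtain q where q: "q \<in> Vh2 D" "ae_eq (Om D) q ?d" by (auto simp: Vh2c_def)
  have "div_h D v = q"
    unfolding div_h_def rep_def
  proof (rule the_equality)
    show "q \<in> Vh2 D \<and> ae_eq (Om D) q ?d" using q by blast
    fix p assume p: "p \<in> Vh2 D \<and> ae_eq (Om D) p ?d"
    then have "ae_eq (Om D) p ?d" by blast
    then have "ae_eq (Om D) p q" using q(2) by eventually_elim simp
    then show "p = q" using p q(1) by (intro broken_space_ae_eq[OF V]) auto
  qed
  then show "div_h D v \<in> Vh2 D" "ae_eq (Om D) (div_h D v) ?d" using q by auto
qed

text \<open>The weak divergence is linear only almost everywhere; both sides lie in
  \<open>Vh2\<close>, which upgrades this to equality.\<close>

lemma div_h_linear:
  assumes D: "broken_discretization D" and v: "v \<in> Vh1 D" and w: "w \<in> Vh1 D"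
  shows "div_h D (\<lambda>x. v x + c *\<^sub>R w x) = (\<lambda>x. div_h D v x + c * div_h D w x)"
proof -
  have V: "broken_space (Om D) (Vh2 D)" "broken_space (Om D) (Vh1 D)" and S: "admissible (setting D)"
    using D by (auto simp: broken_discretization_def)
  have u: "(\<lambda>x. v x + c *\<^sub>R w x) \<in> Vh1 D" using V(2) v w by (rule broken_space_add)
  have "(\<lambda>x. P1c D v x + c *\<^sub>R P1c D w x) \<in> V1 (setting D)"
    using P1c_V1(2)[OF D u] unfolding P1c_linear[OF D v w] .
  then have lin: "ae_eq (Om D) (wdiv (setting D) (P1c D (\<lambda>x. v x + c *\<^sub>R w x)))
      (\<lambda>x. wdiv (setting D) (P1c D v) x + c * wdiv (setting D) (P1c D w) x)"
    unfolding P1c_linear[OF D v w] by (intro wdiv_linear S P1c_V1(2)[OF D] v w)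
  show ?thesis
  proof (rule broken_space_ae_eq[OF V(1) div_h(1)[OF D u]])
    show "(\<lambda>x. div_h D v x + c * div_h D w x) \<in> Vh2 D"
      using broken_space_add[OF V(1) div_h(1)[OF D v] div_h(1)[OF D w], of c] by simp
    show "ae_eq (Om D) (div_h D (\<lambda>x. v x + c *\<^sub>R w x)) (\<lambda>x. div_h D v x + c * div_h D w x)"
      using lin div_h(2)[OF D u] div_h(2)[OF D v] div_h(2)[OF D w] by eventually_elim simp
  qed
qed

lemma tgrad_h:
  assumes D: "broken_discretization D" and q: "q \<in> L2 (Om D)"
  shows "tgrad_h D q \<in> Vh1 D" "\<And>v. v \<in> Vh1 D \<Longrightarrow> ip (Om D) (tgrad_h D q) v = - ip (Om D) q (div_h D v)"
proof -
  let ?\<Omega> = "Om D"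
  have V: "broken_space ?\<Omega> (Vh1 D)" and V2: "broken_space ?\<Omega> (Vh2 D)"
    using D by (auto simp: broken_discretization_def)
  obtain B where B: "finite B" "B \<subseteq> L2 ?\<Omega>" "Vh1 D = lin B" using V by (rule broken_space_lin)
  have dL: "div_h D v \<in> L2 ?\<Omega>" if "v \<in> Vh1 D" for v
    using div_h(1)[OF D that] V2 by (auto simp: broken_space_def)
  define l where "l v = - ip ?\<Omega> q (div_h D v)" for v
  have l: "l (\<lambda>x. v x + c *\<^sub>R w x) = l v + c * l w" if v: "v \<in> Vh1 D" and w: "w \<in> Vh1 D" for v w c
  proof -
    have "l (\<lambda>x. v x + c *\<^sub>R w x) = - ip ?\<Omega> q (\<lambda>x. div_h D v x + c *\<^sub>R div_h D w x)"
      unfolding l_def div_h_linear[OF D v w] by simp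
    also have "\<dots> = l v + c * l w"
      unfolding l_def ip_add_right[OF dL[OF v] L2_scale[OF dL[OF w]] q] ip_scale_right by simp
    finally show ?thesis .
  qed
  have l0: "l v = 0" if v: "v \<in> Vh1 D" "ip ?\<Omega> v v = 0" for v
  proof -
    have "ae_eq ?\<Omega> v (\<lambda>x. 0)" using v V ip_self_eq_0_iff[of v ?\<Omega>] by (auto simp: broken_space_def)
    then have v0: "v = (\<lambda>x. 0)" using v V by (auto simp: broken_space_def)
    \<comment> \<open>At the zero function additivity reads \<open>l 0 = l 0 + l 0\<close>.\<close>
    show ?thesis using l[OF v(1) v(1), of 1] unfolding v0 by simp
  qed
  let ?P = "\<lambda>g. g \<in> Vh1 D \<and>
    (\<forall>v\<in>Vh1 D. integ ?\<Omega> (\<lambda>x. g x \<bullet> v x) = - integ ?\<Omega> (\<lambda>x. q x * div_h D v x))"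
  have P: "?P g \<longleftrightarrow> g \<in> Vh1 D \<and> (\<forall>v\<in>Vh1 D. ip ?\<Omega> g v = l v)" for g by (simp add: ip_def l_def)
  have "\<exists>g\<in>lin B. \<forall>v\<in>lin B. ip ?\<Omega> g v = l v"
    by (rule Riesz_lin[OF B(1,2)]) (use l l0 B(3) in auto)
  then have "\<exists>g. g \<in> Vh1 D \<and> (\<forall>v\<in>Vh1 D. ip ?\<Omega> g v = l v)" unfolding B(3) Bex_def .
  then have "\<exists>g. ?P g" unfolding P .
  moreover have "g = h" if "?P g" "?P h" for g h
    using V that unfolding P by (intro broken_space_ip_cancel[of ?\<Omega> "Vh1 D"]) auto
  ultimately have "\<exists>!g. ?P g" by (rule ex_ex1I)
  then have "?P (tgrad_h D q)" unfolding tgrad_h_def by (rule theI')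
  then have *: "tgrad_h D q \<in> Vh1 D \<and> (\<forall>v\<in>Vh1 D. ip ?\<Omega> (tgrad_h D q) v = l v)" unfolding P .
  then show "tgrad_h D q \<in> Vh1 D" by (rule conjunct1)
  show "ip ?\<Omega> (tgrad_h D q) v = - ip ?\<Omega> q (div_h D v)" if "v \<in> Vh1 D" for v
    using bspec[OF conjunct2[OF *] that] unfolding l_def .
qed

text \<open>The sum is treated through the adjoint definition of \<open>tgrad_h\<close>, where
  linearity is that of the integral, instead of through linearity of \<open>tgrad_h\<close> as an
  operator.\<close>

lemma tgrad_h_add_projection:
  assumes D: "broken_discretization D" and q: "q \<in> Vh2 D" and \<psi>: "\<psi> \<in> H1 (setting D)" and v: "v \<in> Vh1 D"
  shows "ip (Om D) (tgrad_h D (\<lambda>x. q x + L2_proj (Om D) (Vh2 D) \<psi> x)) v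
    = ip (Om D) (tgrad_h D q) v + ip (Om D) (wgrad (setting D) \<psi>) (P1c D v)"
proof -
  let ?\<Omega> = "Om D" and ?p = "L2_proj (Om D) (Vh2 D) \<psi>"
  have V: "broken_space ?\<Omega> (Vh2 D)" and S: "admissible (setting D)" using D by (auto simp: broken_discretization_def)
  have L: "f \<in> L2 ?\<Omega>" if "f \<in> Vh2 D" for f using V that by (auto simp: broken_space_def)
  have \<psi>L: "\<psi> \<in> L2 ?\<Omega>" using \<psi> by (simp add: H1_def)
  note proj = L2_proj[OF V \<psi>L]
  note d = div_h[OF D v] L[OF div_h(1)[OF D v]]
  note qL = L[OF q] and pL = L[OF proj(1)]
  have "ip ?\<Omega> (tgrad_h D (\<lambda>x. q x + ?p x)) v = - ip ?\<Omega> (\<lambda>x. q x + ?p x) (div_h D v)"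
    using D L2_add[OF qL pL] v by (rule tgrad_h(2))
  also have "\<dots> = - ip ?\<Omega> q (div_h D v) - ip ?\<Omega> \<psi> (div_h D v)"
    using ip_add_left[OF qL pL d(3)] proj(2)[OF d(1)] by simp
  also have "- ip ?\<Omega> q (div_h D v) = ip ?\<Omega> (tgrad_h D q) v" using tgrad_h(2)[OF D qL v] by simp
  also have "ip ?\<Omega> \<psi> (div_h D v) = ip ?\<Omega> \<psi> (wdiv (setting D) (P1c D v))"
    using \<psi>L d wdiv_L2[OF V1_Hdiv[OF P1c_V1(2)[OF D v]]] by (intro ip_cong_AE) auto
  also have "\<dots> = - ip ?\<Omega> (wgrad (setting D) \<psi>) (P1c D v)"
    using Green[OF S \<psi>L has_weak_grad_wgrad[OF \<psi>] P1c_V1(2)[OF D v]] by simp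
  finally show ?thesis by simp
qed

theorem proposition9:
  fixes D :: discretization
    and \<nu> T :: real
    and f u :: "real \<Rightarrow> real^2 \<Rightarrow> real^2"
    and p \<psi> :: "real \<Rightarrow> real^2 \<Rightarrow> real"
  assumes "broken_discretization D"
    and "\<nu> \<ge> 0" and "T > 0"
    and "\<And>t. t \<in> {0..T} \<Longrightarrow> f t \<in> L2 (Om D)"
    and "\<And>t. t \<in> {0..T} \<Longrightarrow> \<psi> t \<in> H1 (setting D)"
  shows "solves D \<nu> T f u p \<longleftrightarrow>
         solves D \<nu> T (\<lambda>t x. f t x + wgrad (setting D) (\<psi> t) x) u
           (\<lambda>t x. p t x + L2_proj (Om D) (Vh2 D) (\<psi> t) x)"
proof -
  note D = assms(1)
  let ?\<Omega> = "Om D"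
  define F where "F = (\<lambda>t x. f t x + wgrad (setting D) (\<psi> t) x)"
  define R where "R = (\<lambda>t x. p t x + L2_proj ?\<Omega> (Vh2 D) (\<psi> t) x)"
  have V: "broken_space ?\<Omega> (Vh2 D)" using D by (auto simp: broken_discretization_def)
  have \<psi>L: "\<psi> t \<in> L2 ?\<Omega>" if "t \<in> {0..T}" for t using assms(5)[OF that] by (simp add: H1_def)
  \<comment> \<open>Membership of the pressure is part of being a solution, so the equivalence has
    to recover it in both directions.\<close>
  have mem: "R t \<in> Vh2 D \<longleftrightarrow> p t \<in> Vh2 D" if t: "t \<in> {0..T}" for t
  proof
    assume "R t \<in> Vh2 D"
    from broken_space_diff[OF V this L2_proj(1)[OF V \<psi>L[OF t]]] show "p t \<in> Vh2 D" by (simp add: R_def)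
  next
    assume "p t \<in> Vh2 D"
    from broken_space_add[OF V this L2_proj(1)[OF V \<psi>L[OF t]], of 1] show "R t \<in> Vh2 D" by (simp add: R_def)
  qed
  have lhs: "integ ?\<Omega> (\<lambda>x. tgrad_h D (R t) x \<bullet> v x)
      = integ ?\<Omega> (\<lambda>x. tgrad_h D (p t) x \<bullet> v x) + ip ?\<Omega> (wgrad (setting D) (\<psi> t)) (P1c D v)"
    if "t \<in> {0..T}" "p t \<in> Vh2 D" "v \<in> Vh1 D" for t v
    using tgrad_h_add_projection[OF D that(2) assms(5)[OF that(1)] that(3)] by (simp add: ip_def R_def)
  have rhs: "integ ?\<Omega> (\<lambda>x. F t x \<bullet> P1c D v x)
      = integ ?\<Omega> (\<lambda>x. f t x \<bullet> P1c D v x) + ip ?\<Omega> (wgrad (setting D) (\<psi> t)) (P1c D v)"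
    if t: "t \<in> {0..T}" and v: "v \<in> Vh1 D" for t v
  proof -
    have "wgrad (setting D) (\<psi> t) \<in> L2 ?\<Omega>"
      using has_weak_grad_wgrad[OF assms(5)[OF t]] by (simp add: has_weak_grad_def)
    from ip_add_left[OF assms(4)[OF t] this V1_L2[OF P1c_V1(2)[OF D v]]]
    show ?thesis by (simp add: ip_def F_def)
  qed
  \<comment> \<open>Makes the identity for test fields applicable to the second equation, which is
    tested with \<open>tgrad_h D q\<close>.\<close>
  have tg: "tgrad_h D q \<in> Vh1 D" if "q \<in> Vh2 D" for q
    using tgrad_h(1)[OF D] V that by (auto simp: broken_space_def)
  \<comment> \<open>The two equations for one instant and one test function, with pressure and load
    as parameters. Passing from \<open>p\<close>, \<open>f\<close> to \<open>R\<close>,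
    \<open>F\<close> adds the same number to both sides of each, and the velocity terms are carried
    along untouched.\<close>
  define M where "M P g t v \<longleftrightarrow>
      integ ?\<Omega> (\<lambda>x. ddt T u t x \<bullet> v x)
      + integ ?\<Omega> (\<lambda>x. u t x \<bullet> s_h D (u t) v x)
      + integ ?\<Omega> (\<lambda>x. tgrad_h D (P t) x \<bullet> v x)
      + \<nu> * integ ?\<Omega> (\<lambda>x. tcurl_h D (u t) x * tcurl_h D v x)
      = integ ?\<Omega> (\<lambda>x. g t x \<bullet> P1c D v x)" for P g t v
  define N where "N P g t q \<longleftrightarrow>
      integ ?\<Omega> (\<lambda>x. u t x \<bullet> s_h D (u t) (tgrad_h D q) x)
      + integ ?\<Omega> (\<lambda>x. tgrad_h D (P t) x \<bullet> tgrad_h D q x)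
      = integ ?\<Omega> (\<lambda>x. g t x \<bullet> P1c D (tgrad_h D q) x)" for P g t q
  have solves: "solves D \<nu> T g u P \<longleftrightarrow> (\<forall>t\<in>{0..T}. u t \<in> Vh1 D \<and> P t \<in> Vh2 D) \<and> C1_in_time ?\<Omega> T u \<and>
      (\<forall>t\<in>{0..T}. (\<forall>v\<in>Vh1 D. M P g t v) \<and> (\<forall>q\<in>Vh2 D. N P g t q))" for g P
    unfolding solves_def M_def N_def ..
  have M: "M R F t v \<longleftrightarrow> M p f t v" if "t \<in> {0..T}" "p t \<in> Vh2 D" "v \<in> Vh1 D" for t v
    unfolding M_def lhs[OF that] rhs[OF that(1,3)] by linarith
  have N: "N R F t q \<longleftrightarrow> N p f t q" if "t \<in> {0..T}" "p t \<in> Vh2 D" "q \<in> Vh2 D" for t q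
    unfolding N_def lhs[OF that(1,2) tg[OF that(3)]] rhs[OF that(1) tg[OF that(3)]] by linarith
  have "solves D \<nu> T f u p \<longleftrightarrow> solves D \<nu> T F u R"
    unfolding solves using mem M N by blast
  then show ?thesis by (simp only: F_def R_def)
qed

end
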